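(* Let $M$ be a matroid of rank $r$ on a nonempty finite set $E$ with $|E|=n\ge 2r$. Then $$\omega^\circ(M)=\sum_{S_\bullet}(-1)^{k-1}\,\#\{\text{Ferroni paths weakly above all of } p_M(S_1),\dots,p_M(S_{k-1})\},$$ the sum over all chains $S_\bullet=(\emptyset=S_0\subsetneq S_1\subsetneq\dots\subsetneq S_k=E)$ of crowded subsets of $E$, and also $$\omega^\circ(M)=\sum_{F_\bullet}(-1)^{k-1}\,\#\{\text{Ferroni paths weakly above all of } p_M(F_1),\dots,p_M(F_{k-1})\},$$ the sum over all chains $F_\bullet=(F_0\subsetneq F_1\subsetneq\dots\subsetneq F_k)$ of crowded flats of $M$ that include the minimum crowded flat $F_0=\operatorname{cl}_M(\emptyset)$ and the maximum crowded flat $F_k=E$.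
   Context: **Crowding.** For $S\subseteq E$, $\operatorname{crowd}(S)=|S|-2\operatorname{rank}_M(S)$; $S$ is crowded if $\operatorname{crowd}(S)\ge0$. **Ferroni paths.** For $S\subseteq E$, $p_M(S)=(|S|-\operatorname{rank}_M(S),\operatorname{rank}_M(S))\in\mathbb Z^2$. A Ferroni path here is a lattice path from $(\tfrac12,\tfrac12)$ to $(n-r-\tfrac12,r-\tfrac12)$ with steps $(1,1)$ or $(1,0)$; thus a sequence of $n-r-1$ steps of which exactly $r-1$ are $(1,1)$ (there are none if this is impossible). It lies weakly above an integer point $(a,b)$ if it does not pass strictly below it (passing through is allowed); explicitly, if at least $b$ of its first $\min(a,n-r-1)$ steps are $(1,1)$. **$g$ and $\omega$.** Let $c(M)$ be the number of connected components of $M$. Speyer's $g$-polynomial $g_M(t)\in\mathbb Z[t]$ is given as follows (in the form of Berget–Eur–Spink–Tseng, equivalent to the original $K$-theoretic definition). If $E=\emptyset$, $g_M=1$. If $M$ has a loop or a coloop, $g_M=0$. Otherwise, for each total ordering $w=(w_1,\dots,w_n)$ of $E$, let $B_w$ be the basis with $w_k\in B_w$ iff $\operatorname{rank}\{w_1,\dots,w_k\}>\operatorname{rank}\{w_1,\dots,w_{k-1}\}$. In $\mathbb Z[z_e:e\in E]$, let $x^w$ be the list of the $z_b$, $b\in B_w$; let $y^w$ be the list of the $-z_c$, $c\in E\setminus B_w$; let $\alpha^w=-z_{w_n}$. For a family $f=(f_w)_w$ put $\deg f=\sum_w f_w/\prod_{i=1}^{n-1}(z_{w_i}-z_{w_{i+1}})$.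 With $\boldsymbol e_k$ the $k$-th elementary symmetric polynomial, $$g_M(t)=(-1)^{c(M)}\sum_{i=1}^{r}(-t)^i\sum_{j=0}^{i-1}\deg\big(\alpha^j\,\boldsymbol e_{i-j-1}(-y)\,\boldsymbol e_{r-i}(x)\,\boldsymbol e_{n-r}(y)\big).$$ $\omega(M)$ is the coefficient of $t^r$ in $g_M(t)$, and $\omega^\circ(M)=(-1)^{c(M)-1}\omega(M)$.
   Formalization: The second identity (crowded flats) is stated only for matroids without loops; with loops it fails, e.g. a loop plus U_{1,2} (n=3, r=1), where ω° is 0 but the sum over flat chains is 1. *)

theory Defs
  imports
    Complex_Main
    "HOL-Library.Poly_Mapping"
    "HOL-Library.Product_Plus"
    "HOL-Computational_Algebra.Polynomial"
    "HOL-Computational_Algebra.Fraction_Field"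
    "HOL-Combinatorics.Multiset_Permutations"
begin

section \<open>Matroids\<close>

locale matroid =
  fixes E :: "'a set" and I :: "'a set set"
  assumes finite_ground: "finite E"
    and indep_subset: "X \<in> I \<Longrightarrow> X \<subseteq> E"
    and indep_empty: "{} \<in> I"
    and indep_down: "X \<in> I \<Longrightarrow> Y \<subseteq> X \<Longrightarrow> Y \<in> I"
    and indep_augment:
      "X \<in> I \<Longrightarrow> Y \<in> I \<Longrightarrow> card X < card Y \<Longrightarrow> \<exists>y\<in>Y - X. insert y X \<in> I"

definition mat_rank :: "'a set set \<Rightarrow> 'a set \<Rightarrow> nat" where
  "mat_rank I S = Max (card ` {X \<in> I. X \<subseteq> S})"

definition mat_basis :: "'a set set \<Rightarrow> 'a set \<Rightarrow> bool" where
  "mat_basis I B \<longleftrightarrow> B \<in> I \<and> (\<forall>X\<in>I. B \<subseteq> X \<longrightarrow> X = B)"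

definition mat_circuit :: "'a set \<Rightarrow> 'a set set \<Rightarrow> 'a set \<Rightarrow> bool" where
  "mat_circuit E I C \<longleftrightarrow> C \<subseteq> E \<and> C \<notin> I \<and> (\<forall>X. X \<subset> C \<longrightarrow> X \<in> I)"

definition mat_loop :: "'a set \<Rightarrow> 'a set set \<Rightarrow> 'a \<Rightarrow> bool" where
  "mat_loop E I e \<longleftrightarrow> e \<in> E \<and> {e} \<notin> I"

definition mat_coloop :: "'a set \<Rightarrow> 'a set set \<Rightarrow> 'a \<Rightarrow> bool" where
  "mat_coloop E I e \<longleftrightarrow> e \<in> E \<and> (\<forall>B. mat_basis I B \<longrightarrow> e \<in> B)"

definition mat_closure :: "'a set \<Rightarrow> 'a set set \<Rightarrow> 'a set \<Rightarrow> 'a set" where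
  "mat_closure E I S = {e \<in> E. mat_rank I (insert e S) = mat_rank I S}"

definition mat_flat :: "'a set \<Rightarrow> 'a set set \<Rightarrow> 'a set \<Rightarrow> bool" where
  "mat_flat E I F \<longleftrightarrow> F \<subseteq> E \<and> mat_closure E I F = F"

text \<open>The connected components of a matroid are the classes of the equivalence relation
  in which distinct elements are related iff some circuit contains both.\<close>

definition mat_conn :: "'a set \<Rightarrow> 'a set set \<Rightarrow> ('a \<times> 'a) set" where
  "mat_conn E I = {(e, f). e \<in> E \<and> f \<in> E \<and>
     (e = f \<or> (\<exists>C. mat_circuit E I C \<and> e \<in> C \<and> f \<in> C))}"

definition num_components :: "'a set \<Rightarrow> 'a set set \<Rightarrow> nat" where
  "num_components E I = card (E // mat_conn E I)"


section \<open>Crowded sets and Ferroni paths\<close>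

definition crowd :: "'a set set \<Rightarrow> 'a set \<Rightarrow> int" where
  "crowd I S = int (card S) - 2 * int (mat_rank I S)"

definition crowded :: "'a set \<Rightarrow> 'a set set \<Rightarrow> 'a set \<Rightarrow> bool" where
  "crowded E I S \<longleftrightarrow> S \<subseteq> E \<and> crowd I S \<ge> 0"

definition rank_point :: "'a set set \<Rightarrow> 'a set \<Rightarrow> int \<times> int" where
  "rank_point I S = (int (card S) - int (mat_rank I S), int (mat_rank I S))"

text \<open>A path is the list of its steps; the starting point is \<open>(1/2, 1/2)\<close>.\<close>

definition ferroni_paths :: "nat \<Rightarrow> nat \<Rightarrow> (rat \<times> rat) list set" where
  "ferroni_paths n r = {P. set P \<subseteq> {(1, 1), (1, 0)} \<and>
     (1/2, 1/2) + sum_list P = (of_nat n - of_nat r - 1/2, of_nat r - 1/2)}"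

text \<open>At least \<open>b\<close> of the first \<open>a\<close> steps (or of all steps, if there are fewer) are diagonal.
  Since a path is at abscissa \<open>a\<close> halfway through its \<open>a\<close>-th step, this says that it does not
  pass strictly below \<open>(a, b)\<close>.\<close>

definition weakly_above :: "(rat \<times> rat) list \<Rightarrow> int \<times> int \<Rightarrow> bool" where
  "weakly_above P p = (case p of (a, b) \<Rightarrow>
     b \<le> int (count_list (take (nat (min a (int (length P)))) P) (1, 1)))"

definition num_ferroni_above :: "nat \<Rightarrow> nat \<Rightarrow> (int \<times> int) list \<Rightarrow> nat" where
  "num_ferroni_above n r ps =
     card {P \<in> ferroni_paths n r. \<forall>p\<in>set ps. weakly_above P p}"

text \<open>A chain \<open>S\<^sub>0 \<subset> \<dots> \<subset> S\<^sub>k\<close> is the list of its \<open>k + 1\<close> members, so that \<open>k - 1\<close> is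
  \<open>length Ss - 2\<close> and \<open>butlast (tl Ss)\<close> lists the inner members \<open>S\<^sub>1, \<dots>, S\<^bsub>k-1\<^esub>\<close>.\<close>

definition crowded_chains :: "'a set \<Rightarrow> 'a set set \<Rightarrow> 'a set list set" where
  "crowded_chains E I = {Ss. Ss \<noteq> [] \<and> hd Ss = {} \<and> last Ss = E \<and>
     sorted_wrt (\<subset>) Ss \<and> (\<forall>S\<in>set Ss. crowded E I S)}"

definition crowded_flat_chains :: "'a set \<Rightarrow> 'a set set \<Rightarrow> 'a set list set" where
  "crowded_flat_chains E I = {Fs. Fs \<noteq> [] \<and> hd Fs = mat_closure E I {} \<and> last Fs = E \<and>
     sorted_wrt (\<subset>) Fs \<and> (\<forall>F\<in>set Fs. mat_flat E I F \<and> crowded E I F)}"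

section \<open>The polynomial ring \<open>\<int>[z\<^sub>e]\<close>\<close>

text \<open>A copy of the type \<open>('a \<Rightarrow>\<^sub>0 nat) \<Rightarrow>\<^sub>0 int\<close>. The library shows that type to be an
  integral domain only for linearly ordered \<open>'a\<close>; the copy is one for every \<open>'a\<close>, so that
  its fraction field can be formed. Variables outside the ground set simply do not occur.\<close>

typedef 'a zpoly = "UNIV :: (('a \<Rightarrow>\<^sub>0 nat) \<Rightarrow>\<^sub>0 int) set" ..

setup_lifting type_definition_zpoly

instantiation zpoly :: (type) comm_ring_1
begin

lift_definition zero_zpoly :: "'a zpoly" is 0 .
lift_definition one_zpoly :: "'a zpoly" is 1 .
lift_definition plus_zpoly :: "'a zpoly \<Rightarrow> 'a zpoly \<Rightarrow> 'a zpoly" is "(+)" .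
lift_definition minus_zpoly :: "'a zpoly \<Rightarrow> 'a zpoly \<Rightarrow> 'a zpoly" is "(-)" .
lift_definition uminus_zpoly :: "'a zpoly \<Rightarrow> 'a zpoly" is uminus .
lift_definition times_zpoly :: "'a zpoly \<Rightarrow> 'a zpoly \<Rightarrow> 'a zpoly" is "(*)" .

instance
  by intro_classes
    (simp_all add: zero_zpoly.rep_eq one_zpoly.rep_eq plus_zpoly.rep_eq minus_zpoly.rep_eq
      uminus_zpoly.rep_eq times_zpoly.rep_eq ac_simps distrib_left distrib_right flip: Rep_zpoly_inject)

end

lift_definition zvar :: "'a \<Rightarrow> 'a zpoly" is
  "\<lambda>e. Poly_Mapping.single (Poly_Mapping.single e 1) 1" .

lemma additive_separating_coordinates:
  fixes A :: "('a \<Rightarrow>\<^sub>0 nat) set"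
  assumes "finite A" "finite V"
  shows "\<exists>h :: ('a \<Rightarrow>\<^sub>0 nat) \<Rightarrow> nat. (\<forall>m m'. h (m + m') = h m + h m') \<and>
    (\<forall>m\<in>A. \<forall>m'\<in>A. h m = h m' \<longrightarrow>
       (\<forall>v\<in>V. Poly_Mapping.lookup m v = Poly_Mapping.lookup m' v))"
  using assms(2)
proof (induction V rule: finite_induct)
  case empty
  show ?case by (rule exI[of _ "\<lambda>_. 0"]) simp
next
  case (insert v V)
  then obtain h :: "('a \<Rightarrow>\<^sub>0 nat) \<Rightarrow> nat"
    where h: "\<And>m m'. h (m + m') = h m + h m'"
      and inj: "\<And>m m' u. m \<in> A \<Longrightarrow> m' \<in> A \<Longrightarrow> h m = h m' \<Longrightarrow> u \<in> V \<Longrightarrow>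
        Poly_Mapping.lookup m u = Poly_Mapping.lookup m' u"
    by blast
  define N where "N = Suc (\<Sum>m\<in>A. Poly_Mapping.lookup m v)"
  have N: "Poly_Mapping.lookup m v < N" if "m \<in> A" for m
    using member_le_sum[of m A "\<lambda>m. Poly_Mapping.lookup m v"] that assms(1)
    by (simp add: N_def less_Suc_eq_le)
  define h' where "h' m = Poly_Mapping.lookup m v + N * h m" for m
  have "Poly_Mapping.lookup m u = Poly_Mapping.lookup m' u"
    if "m \<in> A" "m' \<in> A" "h' m = h' m'" "u \<in> insert v V" for m m' u
  proof -
    have "h' m mod N = h' m' mod N" "h' m div N = h' m' div N"
      using that(3) by simp_all
    then have "Poly_Mapping.lookup m v = Poly_Mapping.lookup m' v" "h m = h m'"
      using N[OF that(1)] N[OF that(2)] by (simp_all add: h'_def)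
    then show ?thesis using inj that by auto
  qed
  moreover have "\<And>m m'. h' (m + m') = h' m + h' m'"
    by (simp_all add: h'_def h lookup_add algebra_simps)
  ultimately show ?case by (intro exI[of _ h'] conjI allI ballI impI)
qed

lemma additive_separating:
  fixes A :: "('a \<Rightarrow>\<^sub>0 nat) set"
  assumes "finite A"
  obtains h :: "('a \<Rightarrow>\<^sub>0 nat) \<Rightarrow> nat"
  where "\<And>m m'. h (m + m') = h m + h m'" "inj_on h A"
proof -
  let ?V = "\<Union>m\<in>A. Poly_Mapping.keys m"
  have "finite ?V" using assms by simp
  from additive_separating_coordinates[OF assms this]
  obtain h :: "('a \<Rightarrow>\<^sub>0 nat) \<Rightarrow> nat"
    where H: "(\<forall>m m'. h (m + m') = h m + h m') \<and>
      (\<forall>m\<in>A. \<forall>m'\<in>A. h m = h m' \<longrightarrow>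
         (\<forall>v\<in>?V. Poly_Mapping.lookup m v = Poly_Mapping.lookup m' v))"
    by (rule exE)
  have h: "h (m + m') = h m + h m'" for m m'
    by (rule H[THEN conjunct1, rule_format])
  have sep: "Poly_Mapping.lookup m u = Poly_Mapping.lookup m' u"
    if "m \<in> A" "m' \<in> A" "h m = h m'" "u \<in> ?V" for m m' u
    by (rule H[THEN conjunct2, rule_format, OF that])
  have "inj_on h A"
  proof (rule inj_onI, rule poly_mapping_eqI)
    fix m m' u assume a: "m \<in> A" "m' \<in> A" "h m = h m'"
    show "Poly_Mapping.lookup m u = Poly_Mapping.lookup m' u"
    proof (cases "u \<in> ?V")
      case True
      then show ?thesis by (rule sep[OF a])
    next
      case False
      then show ?thesis using a by (auto simp: in_keys_iff)
    qed
  qed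
  with h show ?thesis by (rule that)
qed

lemma frag_extend_mult:
  fixes h :: "('a \<Rightarrow>\<^sub>0 nat) \<Rightarrow> nat" and p q :: "('a \<Rightarrow>\<^sub>0 nat) \<Rightarrow>\<^sub>0 int"
  assumes h: "\<And>m m'. h (m + m') = h m + h m'"
  shows "frag_extend (frag_of \<circ> h) (p * q) =
    frag_extend (frag_of \<circ> h) p * frag_extend (frag_of \<circ> h) q"
proof -
  let ?F = "frag_extend (frag_of \<circ> h)"
  have single: "?F (frag_of m * q) = ?F (frag_of m) * ?F q" for m
  proof (rule frag_induction[of q UNIV "\<lambda>q. ?F (frag_of m * q) = ?F (frag_of m) * ?F q"])
    fix m' show "?F (frag_of m * frag_of m') = ?F (frag_of m) * ?F (frag_of m')"
      by (simp add: mult_single h)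
  qed (simp_all add: right_diff_distrib frag_extend_diff)
  show ?thesis
    by (rule frag_induction[of p UNIV "\<lambda>p. ?F (p * q) = ?F p * ?F q"])
      (use single in \<open>simp_all add: left_diff_distrib frag_extend_diff\<close>)
qed

lemma frag_extend_inj_nonzero:
  fixes p :: "'b \<Rightarrow>\<^sub>0 int"
  assumes "inj_on h (Poly_Mapping.keys p)" "p \<noteq> 0"
  shows "frag_extend (frag_of \<circ> h) p \<noteq> 0"
proof -
  obtain m where m: "m \<in> Poly_Mapping.keys p" using assms(2) keys_eq_empty by blast
  have "Poly_Mapping.lookup (frag_extend (frag_of \<circ> h) p) (h m) =
      (\<Sum>m'\<in>Poly_Mapping.keys p. Poly_Mapping.lookup p m' * (if h m' = h m then 1 else 0))"
    by (simp add: frag_extend_def lookup_sum) (simp add: eq_commute)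
  also have "\<dots> = (\<Sum>m'\<in>Poly_Mapping.keys p. if m' = m then Poly_Mapping.lookup p m' else 0)"
    by (rule sum.cong) (use assms(1) m in \<open>auto dest: inj_onD\<close>)
  also have "\<dots> = Poly_Mapping.lookup p m" using m by simp
  finally show ?thesis using m by (auto simp: in_keys_iff)
qed

instance zpoly :: (type) idom
proof
  fix a b :: "'a zpoly"
  assume ab: "a \<noteq> 0" "b \<noteq> 0"
  define p where "p = Rep_zpoly a"
  define q where "q = Rep_zpoly b"
  have pq: "p \<noteq> 0" "q \<noteq> 0"
    using ab by (simp_all add: p_def q_def zero_zpoly.rep_eq flip: Rep_zpoly_inject)
  obtain h :: "('a \<Rightarrow>\<^sub>0 nat) \<Rightarrow> nat"
    where h: "\<And>m m'. h (m + m') = h m + h m'"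
      and inj: "inj_on h (Poly_Mapping.keys p \<union> Poly_Mapping.keys q)"
    by (rule additive_separating[of "Poly_Mapping.keys p \<union> Poly_Mapping.keys q"]) (simp, rule that)
  have "frag_extend (frag_of \<circ> h) p \<noteq> 0" "frag_extend (frag_of \<circ> h) q \<noteq> 0"
    by (rule frag_extend_inj_nonzero[OF _ pq(1)] frag_extend_inj_nonzero[OF _ pq(2)],
        use inj in \<open>simp add: inj_on_Un\<close>)+
  then have "frag_extend (frag_of \<circ> h) (p * q) \<noteq> 0"
    by (simp add: frag_extend_mult[OF h])
  then have "p * q \<noteq> 0" by auto
  then show "a * b \<noteq> 0"
    by (simp add: p_def q_def times_zpoly.rep_eq zero_zpoly.rep_eq flip: Rep_zpoly_inject)
qed


section \<open>Speyer's \<open>g\<close>-polynomial\<close>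

text \<open>The \<open>k\<close>-th elementary symmetric polynomial of the finite list \<open>(f a)\<close>, \<open>a \<in> A\<close>.\<close>

definition elem_sym :: "nat \<Rightarrow> 'a set \<Rightarrow> ('a \<Rightarrow> 'b::comm_ring_1) \<Rightarrow> 'b" where
  "elem_sym k A f = (\<Sum>T | T \<subseteq> A \<and> card T = k. \<Prod>a\<in>T. f a)"

definition greedy_basis :: "'a set set \<Rightarrow> 'a list \<Rightarrow> 'a set" where
  "greedy_basis I w = {w ! k | k. k < length w \<and>
     mat_rank I (set (take (Suc k) w)) > mat_rank I (set (take k w))}"

text \<open>List positions count from 0, so the denominator is the product of all
  \<open>z\<close>-differences of consecutive entries of \<open>w\<close>.\<close>

definition best_deg :: "'a set \<Rightarrow> ('a list \<Rightarrow> 'a zpoly) \<Rightarrow> 'a zpoly fract" where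
  "best_deg E f = (\<Sum>w\<in>permutations_of_set E.
     Fract (f w) (\<Prod>i<card E - 1. zvar (w ! i) - zvar (w ! Suc i)))"

text \<open>With \<open>A = B\<^sub>w\<close> and \<open>C = E - B\<^sub>w\<close>: \<open>- zvar (last w)\<close> is \<open>\<alpha>\<^sup>w\<close>,
  \<open>x\<^sup>w\<close> lists \<open>zvar b\<close> for \<open>b \<in> A\<close>, and \<open>y\<^sup>w\<close> lists \<open>- zvar c\<close> for \<open>c \<in> C\<close>.\<close>

definition g_integrand :: "'a set \<Rightarrow> 'a set set \<Rightarrow> nat \<Rightarrow> nat \<Rightarrow> 'a list \<Rightarrow> 'a zpoly" where
  "g_integrand E I i j w =
     (let n = card E; r = mat_rank I E; A = greedy_basis I w; C = E - A;
          x = zvar; y = (\<lambda>c. - zvar c)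
      in (- zvar (last w)) ^ j * elem_sym (i - j - 1) C (\<lambda>c. - y c)
         * elem_sym (r - i) A x * elem_sym (n - r) C y)"

text \<open>The formula for \<open>g\<close> produces rational functions in the \<open>z\<^sub>e\<close> as coefficients, so
  \<open>g\<close> is a polynomial over the fraction field of \<open>\<int>[z\<^sub>e]\<close>. That its coefficients are in fact
  integers is a theorem and not built into the definition.\<close>

definition g_poly :: "'a set \<Rightarrow> 'a set set \<Rightarrow> 'a zpoly fract poly" where
  "g_poly E I =
     (if E = {} then 1
      else if \<exists>e. mat_loop E I e \<or> mat_coloop E I e then 0
      else (-1) ^ num_components E I *
        (\<Sum>i=1..mat_rank I E. smult (\<Sum>j<i. best_deg E (g_integrand E I i j))
           ((- [:0, 1:]) ^ i)))"

definition omega :: "'a set \<Rightarrow> 'a set set \<Rightarrow> 'a zpoly fract" where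
  "omega E I = coeff (g_poly E I) (mat_rank I E)"

definition omega_circ :: "'a set \<Rightarrow> 'a set set \<Rightarrow> 'a zpoly fract" where
  "omega_circ E I = (-1) powi (int (num_components E I) - 1) * omega E I"

end

theory Submission
  imports Defs "HOL-Computational_Algebra.Polynomial_Factorial"
begin

text \<open>If there are no loops or coloops, the last entry of every ordering lies outside its greedy basis. The
  sum over \<open>j\<close> then telescopes, and the top coefficient becomes the sum over all orderings \<open>w\<close> of
  \<open>e\<^bsub>r-1\<^esub>(z\<^bsub>C-last\<^esub>) \<cdot> \<Prod>z\<^sub>C / \<Prod>(z\<^bsub>w(i+1)\<^esub> - z\<^bsub>w(i)\<^esub>)\<close>, where \<open>C\<close> is the complement of the greedy
  basis. A term of the elementary symmetric polynomial chooses \<open>r - 1\<close> of the \<open>n - r - 1\<close> entries of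
  \<open>C - last\<close>, which is a Ferroni path \<open>Q\<close>. For fixed \<open>Q\<close> the numerator is the product of
  \<open>z\<^bsub>w(i)\<^esub>\<close> to the power \<open>h(W\<^sub>i) - h(W\<^bsub>i-1\<^esub>)\<close>, where \<open>W\<^sub>i\<close> is the set of the first \<open>i\<close> entries
  and \<open>h(S)\<close> is the nullity of \<open>S\<close> plus the number of diagonal steps among as many first steps of \<open>Q\<close>.

  For every monotone \<open>h\<close> of total degree \<open>n - 1\<close> such a sum is the constant \<open>- \<mu>(\<emptyset>, E)\<close>, for the
  Moebius function of the family of the \<open>S\<close> with \<open>h(S) \<ge> |S|\<close>, since both sides change in the same way when
  \<open>h\<close> is raised by one at a single set. Here this family consists of the sets whose rank point
  lies weakly below \<open>Q\<close>, which are crowded, and \<open>- \<mu>\<close> is the signed number of its chains. Loops, coloops and the passage to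
  flats are handled by closure operators on this family.\<close>

section \<open>Moebius function of a family of sets\<close>

text \<open>This is the Moebius value from \<open>L\<close> to \<open>U\<close> in the family
  \<open>A\<close> with both ends adjoined, so that one family serves all intervals. The finiteness
  test makes \<open>card U\<close> a termination measure.\<close>

function chain_mu :: "'a set set \<Rightarrow> 'a set \<Rightarrow> 'a set \<Rightarrow> int" where
  "chain_mu A L U = (if finite U then
     if L = U then 1 else - (\<Sum>T | T \<in> insert L A \<and> L \<subseteq> T \<and> T \<subset> U. chain_mu A L T)
   else 0)"
  by pat_completeness auto
termination
  by (relation "measure (\<lambda>(A, L, U). card U)") (auto intro: psubset_card_mono)

declare chain_mu.simps [simp del]

lemma chain_mu_self: "finite L \<Longrightarrow> chain_mu A L L = 1"
  by (simp add: chain_mu.simps)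

lemma chain_mu_rec:
  "finite U \<Longrightarrow> L \<noteq> U \<Longrightarrow>
    chain_mu A L U = - (\<Sum>T | T \<in> insert L A \<and> L \<subseteq> T \<and> T \<subset> U. chain_mu A L T)"
  by (subst chain_mu.simps) simp

lemma finite_interval: "finite U \<Longrightarrow> finite {T. P T \<and> L \<subseteq> T \<and> T \<subset> U}"
  by (auto intro: finite_subset[of _ "Pow U"])

lemma chain_mu_sum_eq_0:
  assumes "finite U" "L \<subset> U" "U \<in> A"
  shows "(\<Sum>T | T \<in> insert L A \<and> L \<subseteq> T \<and> T \<subseteq> U. chain_mu A L T) = 0"
proof -
  have "{T. T \<in> insert L A \<and> L \<subseteq> T \<and> T \<subseteq> U} =
      insert U {T. T \<in> insert L A \<and> L \<subseteq> T \<and> T \<subset> U}"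
    using assms by auto
  then show ?thesis
    using assms chain_mu_rec[of U L A] finite_interval[of U] by simp
qed

lemma chain_mu_cong:
  assumes "finite U" "\<And>T. L \<subset> T \<Longrightarrow> T \<subset> U \<Longrightarrow> T \<in> A \<longleftrightarrow> T \<in> A'"
  shows "chain_mu A L U = chain_mu A' L U"
  using assms
proof (induction "card U" arbitrary: U rule: less_induct)
  case less
  show ?case
  proof (cases "L = U")
    case False
    have "(\<Sum>T | T \<in> insert L A \<and> L \<subseteq> T \<and> T \<subset> U. chain_mu A L T) =
        (\<Sum>T | T \<in> insert L A' \<and> L \<subseteq> T \<and> T \<subset> U. chain_mu A' L T)"
    proof (rule sum.cong)
      show "{T. T \<in> insert L A \<and> L \<subseteq> T \<and> T \<subset> U} = {T. T \<in> insert L A' \<and> L \<subseteq> T \<and> T \<subset> U}"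
        using less.prems(2) by blast
      fix T assume "T \<in> {T. T \<in> insert L A' \<and> L \<subseteq> T \<and> T \<subset> U}"
      then have T: "T \<subset> U" by simp
      with less.prems(1) have "finite T" "card T < card U"
        by (auto intro: finite_subset psubset_card_mono)
      moreover have "X \<in> A \<longleftrightarrow> X \<in> A'" if "L \<subset> X" "X \<subset> T" for X
        using less.prems(2)[of X] that T by blast
      ultimately show "chain_mu A L T = chain_mu A' L T" using less.hyps by blast
    qed
    then show ?thesis using less.prems(1) False by (simp add: chain_mu_rec)
  qed (simp add: less.prems chain_mu_self)
qed

text \<open>A Moebius value is a signed count of chains. The new chains are those through
  \<open>S\<close>; they split at \<open>S\<close> into two independent parts whose signs multiply.
  The proof carries this out on the recursion.\<close>

lemma chain_mu_insert:
  assumes "finite U" "S \<notin> A" "L \<subset> S" "S \<subset> U"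
  shows "chain_mu (insert S A) L U = chain_mu A L U + chain_mu A L S * chain_mu A S U"
  using assms
proof (induction "card U" arbitrary: U rule: less_induct)
  case less
  let ?A = "insert S A"
  let ?I = "\<lambda>A L U. {T. T \<in> insert L A \<and> L \<subseteq> T \<and> T \<subset> U}"
  note fin = finite_interval[OF \<open>finite U\<close>]
  have LS: "chain_mu ?A L T = chain_mu A L T" if "\<not> S \<subset> T" "T \<subset> U" for T
    by (rule chain_mu_cong) (use that less.prems finite_subset in \<open>auto\<close>)
  have eqA: "?I ?A L U = insert S (?I A L U)" "S \<notin> ?I A L U"
    using less.prems by auto
  have "(\<Sum>T\<in>?I ?A L U. chain_mu ?A L T) =
      chain_mu A L S + (\<Sum>T\<in>?I A L U. chain_mu ?A L T)"
    using LS[of S] less.prems fin unfolding eqA(1) by (subst sum.insert) auto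
  also have "(\<Sum>T\<in>?I A L U. chain_mu ?A L T) =
      (\<Sum>T\<in>?I A L U. chain_mu A L T + (if S \<subset> T then chain_mu A L S * chain_mu A S T else 0))"
  proof (rule sum.cong)
    fix T assume T: "T \<in> ?I A L U"
    show "chain_mu ?A L T = chain_mu A L T + (if S \<subset> T then chain_mu A L S * chain_mu A S T else 0)"
      using T less.hyps[of T] LS[of T] less.prems
      by (auto intro: psubset_card_mono finite_subset)
  qed simp
  also have "\<dots> = (\<Sum>T\<in>?I A L U. chain_mu A L T) +
      chain_mu A L S * (\<Sum>T | T \<in> ?I A L U \<and> S \<subset> T. chain_mu A S T)"
    using fin[of "\<lambda>T. T \<in> insert L A"]
    unfolding sum.distrib sum_distrib_left by (subst sum.inter_filter) simp_all
  \<comment> \<open>The recursion for the interval from \<open>S\<close> includes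
    \<open>T = S\<close>, with value 1. Removing it leaves a \<open>-1\<close> that cancels the
    separate summand \<open>chain_mu A L S\<close>.\<close>
  also have "(\<Sum>T | T \<in> ?I A L U \<and> S \<subset> T. chain_mu A S T) = (\<Sum>T\<in>?I A S U. chain_mu A S T) - 1"
  proof -
    have "?I A S U = insert S {T. T \<in> ?I A L U \<and> S \<subset> T}" using less.prems by auto
    moreover have "finite {T. T \<in> ?I A L U \<and> S \<subset> T}"
      using less.prems(1) by (auto intro: finite_subset[of _ "Pow U"])
    moreover have "chain_mu A S S = 1"
      using less.prems finite_subset by (auto intro!: chain_mu_self)
    ultimately show ?thesis by simp
  qed
  also have "(\<Sum>T\<in>?I A S U. chain_mu A S T) = - chain_mu A S U"
    using less.prems by (subst chain_mu_rec) auto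
  also have "(\<Sum>T\<in>?I A L U. chain_mu A L T) = - chain_mu A L U"
    using less.prems by (subst chain_mu_rec) auto
  finally show ?case
    using less.prems by (subst chain_mu_rec) (auto simp: algebra_simps)
qed

text \<open>Rota's closure theorem, for a map \<open>c\<close> that behaves as a closure operator on
  the relevant part of the family. By induction the fibres over closed sets properly below
  \<open>U\<close> are known; comparing the recursion in the family with the one in its closed
  members determines the fibre over \<open>U\<close>.\<close>

lemma chain_mu_closure_fibre:
  assumes "finite U" "L \<subseteq> U" "c U = U"
    and ext: "\<And>T. T \<in> insert L A \<Longrightarrow> L \<subseteq> T \<Longrightarrow> T \<subset> U \<Longrightarrow>
      T \<subseteq> c T \<and> c (c T) = c T \<and> c T \<in> insert L (insert U A)"
    and mono: "\<And>S T. S \<in> insert L A \<Longrightarrow> L \<subseteq> S \<Longrightarrow> S \<subseteq> T \<Longrightarrow> T \<subseteq> U \<Longrightarrow> c T = T \<Longrightarrow> c S \<subseteq> T"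
  shows "(\<Sum>T | T \<in> insert U (insert L A) \<and> L \<subseteq> T \<and> T \<subseteq> U \<and> c T = U. chain_mu A L T) =
    (if c L = L then chain_mu {T \<in> A. c T = T} L U else 0)"
  using assms
proof (induction "card U" arbitrary: U rule: less_induct)
  case less
  let ?A' = "{T \<in> A. c T = T}"
  let ?F = "\<lambda>V. {T. T \<in> insert V (insert L A) \<and> L \<subseteq> T \<and> T \<subseteq> V \<and> c T = V}"
  let ?I = "{T. T \<in> insert L A \<and> L \<subseteq> T \<and> T \<subset> U}"
  let ?J = "{T \<in> ?I. c T = U}"
  let ?K = "{T \<in> ?I. c T \<noteq> U}"
  have fin: "finite ?I" "finite ?J" "finite ?K" "finite L"
    using less.prems by (auto intro: finite_subset[of _ "Pow U"] finite_subset[of _ U])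
  show ?case
  proof (cases "L = U")
    case True
    then have "?F U = {L}" using less.prems by auto
    then show ?thesis using less.prems fin True by (simp add: chain_mu_self)
  next
    case False
    have cT: "c T \<subset> U" "c (c T) = c T" "c T \<in> insert L A" "T \<subseteq> c T" if "T \<in> ?K" for T
      using that less.prems(4)[of T] less.prems(5)[of T U] less.prems(3) by auto
    have fibre: "(\<Sum>T | T \<in> ?K \<and> c T = V. chain_mu A L T) = (if c L = L then chain_mu ?A' L V else 0)"
      if "V \<in> c ` ?K" for V
    proof -
      from that obtain T where T: "V = c T" "T \<in> ?K" by (rule imageE)
      have V: "V \<subset> U" "c V = V" "V \<in> insert L A"
        unfolding T(1) using cT[OF T(2)] by blast+
      have "L \<subseteq> V" unfolding T(1) using cT(4)[OF T(2)] T(2) by blast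
      note V = V this
      have "(\<Sum>T\<in>?F V. chain_mu A L T) = (if c L = L then chain_mu ?A' L V else 0)"
      proof (rule less.hyps)
        show "card V < card U" using V less.prems(1) by (simp add: psubset_card_mono)
        show "finite V" using V less.prems(1) by (auto intro: finite_subset)
        show "T \<subseteq> c T \<and> c (c T) = c T \<and> c T \<in> insert L (insert V A)"
          if T: "T \<in> insert L A" "L \<subseteq> T" "T \<subset> V" for T
        proof -
          have "c T \<subseteq> V" using T V(1,2) by (intro less.prems(5)[of T V]) auto
          then have "c T \<noteq> U" using V by auto
          moreover have "T \<subset> U" using T(3) V(1) by (rule psubset_trans)
          ultimately show ?thesis using less.prems(4)[OF T(1,2)] by blast
        qed
        show "c S \<subseteq> T" if "S \<in> insert L A" "L \<subseteq> S" "S \<subseteq> T" "T \<subseteq> V" "c T = T" for S T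
        proof (rule less.prems(5)[OF that(1-3) _ that(5)])
          show "T \<subseteq> U" using that(4) V(1) by blast
        qed
        show "L \<subseteq> V" "c V = V" by (rule V)+
      qed
      moreover have "?F V = {T. T \<in> ?K \<and> c T = V}"
      proof
        show "?F V \<subseteq> {T. T \<in> ?K \<and> c T = V}" using V by blast
        show "{T. T \<in> ?K \<and> c T = V} \<subseteq> ?F V" using cT(4) by blast
      qed
      ultimately show ?thesis by simp
    qed
    \<comment> \<open>Grouped by closure, the sets that do not close up to \<open>U\<close>
      reproduce the recursion at \<open>U\<close> for the closed members.\<close>
    have "(\<Sum>T\<in>?K. chain_mu A L T) = (\<Sum>V\<in>c ` ?K. \<Sum>T | T \<in> ?K \<and> c T = V. chain_mu A L T)"
      by (rule sum.image_gen[OF fin(3)])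
    also have "\<dots> = (\<Sum>V\<in>c ` ?K. if c L = L then chain_mu ?A' L V else 0)"
      by (rule sum.cong[OF refl fibre])
    also have "\<dots> = - (if c L = L then chain_mu ?A' L U else 0)"
    proof (cases "c L = L")
      case True
      have "c ` ?K = {T. T \<in> insert L ?A' \<and> L \<subseteq> T \<and> T \<subset> U}" (is "_ = ?R")
      proof
        show "c ` ?K \<subseteq> ?R"
        proof (rule image_subsetI)
          fix T assume T: "T \<in> ?K"
          then have "L \<subseteq> c T" using cT(4)[OF T] by blast
          with cT[OF T] show "c T \<in> ?R" by simp
        qed
        show "?R \<subseteq> c ` ?K"
        proof
          fix T assume T: "T \<in> ?R"
          then have "c T = T" using True by auto
          moreover have "T \<in> ?K" using T \<open>c T = T\<close> by auto
          ultimately show "T \<in> c ` ?K" by (rule image_eqI[OF sym])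
        qed
      qed
      then show ?thesis using True False less.prems(1) by (simp add: chain_mu_rec)
    qed simp
    finally have K: "(\<Sum>T\<in>?K. chain_mu A L T) = - (if c L = L then chain_mu ?A' L U else 0)" .
    have split: "?I = ?J \<union> ?K" "?J \<inter> ?K = {}" by auto
    have "(\<Sum>T\<in>?I. chain_mu A L T) = (\<Sum>T\<in>?J. chain_mu A L T) + (\<Sum>T\<in>?K. chain_mu A L T)"
      by (rule trans[OF sum.cong[OF split(1) refl] sum.union_disjoint[OF fin(2,3) split(2)]])
    then have "chain_mu A L U = - (\<Sum>T\<in>?J. chain_mu A L T) + (if c L = L then chain_mu ?A' L U else 0)"
      unfolding chain_mu_rec[OF less.prems(1) False] K by linarith
    moreover have "(\<Sum>T\<in>insert U ?J. chain_mu A L T) = chain_mu A L U + (\<Sum>T\<in>?J. chain_mu A L T)"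
      by (rule sum.insert[OF fin(2)]) simp
    ultimately have "(\<Sum>T\<in>insert U ?J. chain_mu A L T) = (if c L = L then chain_mu ?A' L U else 0)"
      by linarith
    moreover have "?F U = insert U ?J"
      using less.prems(2,3) by auto
    ultimately show ?thesis by (simp only:)
  qed
qed

text \<open>Since \<open>c\<close> maps sets below \<open>U\<close> into \<open>insert L A\<close>,
  which omits \<open>U\<close>, the fibre over \<open>U\<close> is \<open>{U}\<close> and the
  closure theorem speaks of a single Moebius value.\<close>

lemma chain_mu_closure_top:
  assumes "finite U" "L \<subset> U" "c U = U"
    and "\<And>T. T \<in> insert L A \<Longrightarrow> L \<subseteq> T \<Longrightarrow> T \<subset> U \<Longrightarrow> T \<subseteq> c T \<and> c (c T) = c T \<and> c T \<in> insert L A"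
    and "\<And>S T. S \<in> insert L A \<Longrightarrow> L \<subseteq> S \<Longrightarrow> S \<subseteq> T \<Longrightarrow> T \<subseteq> U \<Longrightarrow> c T = T \<Longrightarrow> c S \<subseteq> T"
    and "U \<notin> A"
  shows "chain_mu A L U = (if c L = L then chain_mu {T \<in> A. c T = T} L U else 0)"
proof -
  have "{T. T \<in> insert U (insert L A) \<and> L \<subseteq> T \<and> T \<subseteq> U \<and> c T = U} = {U}"
    (is "?F = _")
  proof
    show "?F \<subseteq> {U}"
    proof
      fix T assume T: "T \<in> ?F"
      have False if "T \<subset> U"
        using T that assms(4)[of T] assms(2,6) by auto
      with T show "T \<in> {U}" by blast
    qed
  qed (use assms(2,3) in auto)
  moreover have "(\<Sum>T\<in>?F. chain_mu A L T) = (if c L = L then chain_mu {T \<in> A. c T = T} L U else 0)"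
  proof (rule chain_mu_closure_fibre)
    show "T \<subseteq> c T \<and> c (c T) = c T \<and> c T \<in> insert L (insert U A)"
      if "T \<in> insert L A" "L \<subseteq> T" "T \<subset> U" for T
      using assms(4)[OF that] by blast
    show "c S \<subseteq> T" if "S \<in> insert L A" "L \<subseteq> S" "S \<subseteq> T" "T \<subseteq> U" "c T = T" for S T
      by (rule assms(5)[OF that])
  qed (use assms(1-3) in auto)
  ultimately show ?thesis by simp
qed

text \<open>The dual argument, for the deletion of \<open>e\<close>. By induction the sets below
  \<open>U\<close> that contain \<open>e\<close> contribute 0, so the recursion runs over the sets
  inside \<open>U - {e}\<close>. That set belongs to the family and lies strictly above
  \<open>L\<close>, so these values cancel.\<close>

lemma chain_mu_kernel_eq_0:
  assumes "finite U" "L \<subset> U" "e \<in> U" "e \<notin> L"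
    and "\<And>T. T \<in> insert U A \<Longrightarrow> e \<in> T \<Longrightarrow> L \<subseteq> T \<Longrightarrow> T \<subseteq> U \<Longrightarrow> T - {e} \<in> A \<and> T - {e} \<noteq> L"
  shows "chain_mu A L U = 0"
  using assms
proof (induction "card U" arbitrary: U rule: less_induct)
  case less
  let ?I = "{T. T \<in> insert L A \<and> L \<subseteq> T \<and> T \<subset> U}"
  let ?D = "{T. T \<in> insert L A \<and> L \<subseteq> T \<and> T \<subseteq> U - {e}}"
  have "(\<Sum>T\<in>?I. chain_mu A L T) = (\<Sum>T\<in>?D. chain_mu A L T)"
  proof (rule sum.mono_neutral_right)
    show "finite ?I" using less.prems(1) by (auto intro: finite_subset[of _ "Pow U"])
    show "?D \<subseteq> ?I" using less.prems(3) by auto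
    show "\<forall>T\<in>?I - ?D. chain_mu A L T = 0"
    proof
      fix T assume T: "T \<in> ?I - ?D"
      then have T': "T \<subset> U" "e \<in> T" "L \<subseteq> T" "T \<in> A" "L \<noteq> T" using less.prems(4) by auto
      show "chain_mu A L T = 0"
      proof (rule less.hyps)
        show "X - {e} \<in> A \<and> X - {e} \<noteq> L"
          if "X \<in> insert T A" "e \<in> X" "L \<subseteq> X" "X \<subseteq> T" for X
          using that T' by (intro less.prems(5)) auto
      qed (use T' less.prems in \<open>auto intro: psubset_card_mono finite_subset\<close>)
    qed
  qed
  also have "\<dots> = 0"
    using less.prems(5)[of U] less.prems(1-4) by (intro chain_mu_sum_eq_0) auto
  finally show ?case using less.prems(1,2) chain_mu_rec[of U L A] by simp
qed

section \<open>Chains as lists and their signed count\<close>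

definition chain_lists :: "'a set set \<Rightarrow> 'a set \<Rightarrow> 'a set \<Rightarrow> 'a set list set" where
  "chain_lists A L U = {Ss. Ss \<noteq> [] \<and> hd Ss = L \<and> last Ss = U \<and>
     sorted_wrt (\<subset>) Ss \<and> set (butlast (tl Ss)) \<subseteq> A}"

lemma sorted_psubset_hd: "sorted_wrt (\<subset>) Ss \<Longrightarrow> S \<in> set Ss \<Longrightarrow> hd Ss \<subseteq> S"
  by (cases Ss) auto

lemma chain_lists_self: "chain_lists A L L = {[L]}"
proof -
  have "Ss = [L]" if "Ss \<in> chain_lists A L L" for Ss
    using that by (cases Ss) (auto simp: chain_lists_def split: if_splits)
  then show ?thesis by (auto simp: chain_lists_def)
qed

lemma chain_lists_rec:
  assumes "L \<noteq> U"
  shows "chain_lists A L U =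
    (\<Union>T\<in>{T. T \<in> insert L A \<and> L \<subseteq> T \<and> T \<subset> U}. (\<lambda>Ss. Ss @ [U]) ` chain_lists A L T)"
    (is "_ = ?R")
proof (intro equalityI subsetI)
  fix Ss assume Ss: "Ss \<in> chain_lists A L U"
  define Ts where "Ts = butlast Ss"
  have eq: "Ss = Ts @ [U]" using Ss by (auto simp: Ts_def chain_lists_def)
  have ne: "Ts \<noteq> []" using Ss assms eq by (auto simp: chain_lists_def)
  have sorted: "sorted_wrt (\<subset>) Ts" "\<forall>T\<in>set Ts. T \<subset> U" and hd: "hd Ts = L"
    and A: "set (tl Ts) \<subseteq> A"
    using Ss ne by (auto simp: eq chain_lists_def sorted_wrt_append butlast_append)
  \<comment> \<open>The member before \<open>U\<close> is \<open>L\<close> itself if the chain has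
    two members, and an inner member otherwise.\<close>
  have "last Ts \<in> insert L A"
    using A hd ne by (cases Ts) (auto dest!: subsetD intro!: last_in_set)
  moreover have "L \<subseteq> last Ts" "last Ts \<subset> U"
    using sorted_psubset_hd[OF sorted(1), of "last Ts"] sorted(2) hd ne by auto
  moreover have "Ts \<in> chain_lists A L (last Ts)"
    using ne sorted(1) hd A in_set_butlastD by (fastforce simp: chain_lists_def)
  ultimately show "Ss \<in> ?R" unfolding eq by blast
next
  fix Ss assume "Ss \<in> ?R"
  then obtain T Ts where T: "T \<in> insert L A" "L \<subseteq> T" "T \<subset> U"
    and Ts: "Ts \<in> chain_lists A L T" and eq: "Ss = Ts @ [U]" by blast
  have Ts': "Ts \<noteq> []" "hd Ts = L" "last Ts = T" "sorted_wrt (\<subset>) Ts" "set (butlast (tl Ts)) \<subseteq> A"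
    using Ts by (auto simp: chain_lists_def)
  obtain Us where Us: "Ts = L # Us" using Ts'(1,2) by (cases Ts) auto
  have "X \<subset> U" if "X \<in> set Ts" for X
  proof -
    have "Ts = butlast Ts @ [T]" using Ts' by (metis append_butlast_last_id)
    with Ts'(4) that have "X \<subseteq> T"
      by (metis in_set_conv_decomp rotate1.simps(2) set_ConsD set_rotate1 sorted_wrt_append
          list.set_intros(1) psubset_imp_subset subset_refl)
    with T(3) show ?thesis by blast
  qed
  moreover have "set Us \<subseteq> A"
  proof (cases "Us = []")
    case False
    then have "last Us = T" "last Us \<in> set Us" using Ts'(3) Us by auto
    moreover from this Ts'(4) have "T \<noteq> L" using Us by auto
    moreover have "set Us = insert (last Us) (set (butlast Us))"
      using append_butlast_last_id[OF False] by (metis Un_insert_right empty_set list.simps(15) set_append sup_bot.right_neutral)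
    ultimately show ?thesis using T(1) Ts'(5) Us by auto
  qed simp
  ultimately show "Ss \<in> chain_lists A L U"
    using Ts'(4) by (auto simp: eq Us chain_lists_def sorted_wrt_append butlast_append)
qed

text \<open>Philip Hall's theorem. Removing the top member of a chain costs one sign and reproduces
  the recursion of \<open>chain_mu\<close>; the exponent is the number of steps of the
  chain.\<close>

lemma chain_lists_sum:
  assumes "finite U" "L \<subseteq> U"
  shows "finite (chain_lists A L U)"
    and "(\<Sum>Ss\<in>chain_lists A L U. (-1) ^ (length Ss - 1)) = chain_mu A L U"
proof -
  have "finite (chain_lists A L U) \<and>
    (\<Sum>Ss\<in>chain_lists A L U. (-1) ^ (length Ss - 1)) = chain_mu A L U"
    using assms
  proof (induction "card U" arbitrary: U rule: less_induct)
    case less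
    show ?case
    proof (cases "L = U")
      case True
      then show ?thesis using less.prems by (simp add: chain_lists_self chain_mu_self)
    next
      case False
      let ?I = "{T. T \<in> insert L A \<and> L \<subseteq> T \<and> T \<subset> U}"
      have fin: "finite ?I" using less.prems(1) by (auto intro: finite_subset[of _ "Pow U"])
      have IH: "finite (chain_lists A L T)"
        "(\<Sum>Ss\<in>chain_lists A L T. (-1) ^ (length Ss - 1)) = chain_mu A L T" if "T \<in> ?I" for T
        using less.hyps[of T] that less.prems(1) by (auto intro: psubset_card_mono finite_subset)
      have "(\<Sum>Ss\<in>chain_lists A L U. (-1::int) ^ (length Ss - 1)) =
          (\<Sum>T\<in>?I. \<Sum>Ss\<in>(\<lambda>Ss. Ss @ [U]) ` chain_lists A L T. (-1) ^ (length Ss - 1))"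
        unfolding chain_lists_rec[OF False]
      proof (rule sum.UNION_disjoint[OF fin])
        show "\<forall>T\<in>?I. finite ((\<lambda>Ss. Ss @ [U]) ` chain_lists A L T)" using IH by blast
        show "\<forall>T\<in>?I. \<forall>T'\<in>?I. T \<noteq> T' \<longrightarrow>
          (\<lambda>Ss. Ss @ [U]) ` chain_lists A L T \<inter> (\<lambda>Ss. Ss @ [U]) ` chain_lists A L T' = {}"
          by (auto simp: chain_lists_def)
      qed
      also have "\<dots> = (\<Sum>T\<in>?I. - chain_mu A L T)"
      proof (rule sum.cong[OF refl])
        fix T assume T: "T \<in> ?I"
        have "(\<Sum>Ss\<in>(\<lambda>Ss. Ss @ [U]) ` chain_lists A L T. (-1::int) ^ (length Ss - 1)) =
            (\<Sum>Ss\<in>chain_lists A L T. (-1) ^ length Ss)"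
          by (subst sum.reindex) (auto simp: inj_on_def)
        also have "\<dots> = (\<Sum>Ss\<in>chain_lists A L T. - ((-1) ^ (length Ss - 1)))"
          by (rule sum.cong[OF refl]) (auto simp: chain_lists_def gr0_conv_Suc simp flip: length_greater_0_conv)
        finally show "(\<Sum>Ss\<in>(\<lambda>Ss. Ss @ [U]) ` chain_lists A L T. (-1) ^ (length Ss - 1)) = - chain_mu A L T"
          using IH(2)[OF T] by (simp add: sum_negf)
      qed
      also have "\<dots> = chain_mu A L U"
        using False less.prems(1) by (simp add: chain_mu_rec sum_negf)
      finally show ?thesis using fin IH(1) unfolding chain_lists_rec[OF False]
        by (intro conjI finite_UN_I finite_imageI) assumption+
    qed
  qed
  then show "finite (chain_lists A L U)"
    "(\<Sum>Ss\<in>chain_lists A L U. (-1) ^ (length Ss - 1)) = chain_mu A L U" by blast+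
qed

section \<open>Sums over orderings\<close>

text \<open>The factors are the negatives of those in \<open>best_deg\<close>. The resulting sign
  \<open>(-1) ^ (card E - 1)\<close> is accounted for when \<open>omega_circ\<close> is
  evaluated.\<close>

fun path_den :: "('a \<Rightarrow> 'k::field) \<Rightarrow> 'a list \<Rightarrow> 'k" where
  "path_den z (x # y # w) = (z y - z x) * path_den z (y # w)"
| "path_den z w = 1"

text \<open>The argument \<open>S\<close> collects the entries already passed. For monotone
  \<open>h\<close> the truncated subtraction is the true increment.\<close>

fun path_num :: "('a \<Rightarrow> 'k::field) \<Rightarrow> ('a set \<Rightarrow> nat) \<Rightarrow> 'a set \<Rightarrow> 'a list \<Rightarrow> 'k" where
  "path_num z h S [] = 1"
| "path_num z h S (x # w) = z x ^ (h (insert x S) - h S) * path_num z h (insert x S) w"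

definition order_sum :: "('a \<Rightarrow> 'k::field) \<Rightarrow> ('a set \<Rightarrow> nat) \<Rightarrow> 'a set \<Rightarrow> 'a set \<Rightarrow> 'k" where
  "order_sum z h L U = (\<Sum>w\<in>permutations_of_set (U - L). path_num z h L w / path_den z w)"

lemma path_den_append:
  "u \<noteq> [] \<Longrightarrow> v \<noteq> [] \<Longrightarrow>
    path_den z (u @ v) = path_den z u * (z (hd v) - z (last u)) * path_den z v"
proof (induction z u rule: path_den.induct)
  case ("2_2" z x)
  then show ?case by (cases v) auto
qed auto

lemma path_den_nth: "path_den z w = (\<Prod>i<length w - 1. z (w ! Suc i) - z (w ! i))"
  by (induction z w rule: path_den.induct) (auto simp: prod.lessThan_Suc_shift simp del: prod.lessThan_Suc)

lemma path_num_append: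
  "path_num z h S (u @ v) = path_num z h S u * path_num z h (S \<union> set u) v"
  by (induction u arbitrary: S) auto

lemma path_num_cong:
  "(\<And>T. S \<subseteq> T \<Longrightarrow> T \<subseteq> S \<union> set w \<Longrightarrow> h T = h' T) \<Longrightarrow> path_num z h S w = path_num z h' S w"
proof (induction w arbitrary: S)
  case (Cons x w)
  have "path_num z h (insert x S) w = path_num z h' (insert x S) w"
    by (rule Cons.IH) (rule Cons.prems, auto)
  moreover have "h S = h' S" "h (insert x S) = h' (insert x S)"
    by (rule Cons.prems; auto)+
  ultimately show ?case by simp
qed simp

lemma path_num_fun_upd:
  assumes "\<And>u v. w = u @ v \<Longrightarrow> L \<union> set u \<noteq> S"
  shows "path_num z (h(S := k)) L w = path_num z h L w"
  using assms
proof (induction w arbitrary: L)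
  case (Cons x w)
  have "path_num z (h(S := k)) (insert x L) w = path_num z h (insert x L) w"
  proof (rule Cons.IH)
    fix u v assume "w = u @ v"
    then show "insert x L \<union> set u \<noteq> S" using Cons.prems[of "x # u" v] by simp
  qed
  moreover have "(h(S := k)) L = h L" "(h(S := k)) (insert x L) = h (insert x L)"
    using Cons.prems[of "[]" "x # w"] Cons.prems[of "[x]" w] by simp_all
  ultimately show ?case by (simp only: path_num.simps)
qed simp

text \<open>Raising \<open>h\<close> at a prefix set \<open>S\<close> moves one unit of exponent:
  the entry that completes \<open>S\<close> gains it, as shown here, and the entry after it loses
  it, as shown next. The inequality on \<open>h\<close> keeps the truncated subtraction
  exact.\<close>

lemma path_num_last_step:
  assumes "u \<noteq> []" "distinct u" "set u \<inter> L = {}" "S = L \<union> set u"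
    and "h (L \<union> set (butlast u)) \<le> h S"
  shows "path_num z (h(S := Suc (h S))) L u = z (last u) * path_num z h L u"
proof -
  define x t where "x = last u" and "t = butlast u"
  have u: "u = t @ [x]" using assms(1) by (simp add: x_def t_def)
  have x: "x \<notin> L \<union> set t" "S = insert x (L \<union> set t)" "h (L \<union> set t) \<le> h S"
    using assms by (auto simp: u)
  have "path_num z (h(S := Suc (h S))) L t = path_num z h L t"
    by (rule path_num_cong) (use x in auto)
  moreover have "L \<union> set t \<noteq> S" using x by blast
  ultimately show ?thesis using x(2,3) by (simp add: u path_num_append Suc_diff_le)
qed

lemma path_num_first_step:
  assumes "v \<noteq> []" "set v \<inter> S = {}" "h S < h (insert (hd v) S)"
  shows "path_num z h S v = z (hd v) * path_num z (h(S := Suc (h S))) S v"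
proof -
  obtain x t where v: "v = x # t" using assms(1) by (cases v) auto
  have "path_num z (h(S := Suc (h S))) (insert x S) t = path_num z h (insert x S) t"
    by (rule path_num_cong) (use assms v in auto)
  moreover have "x \<notin> S" "h S < h (insert x S)" using assms v by auto
  then have "h (insert x S) - h S = Suc (h (insert x S) - Suc (h S))" "insert x S \<noteq> S" by auto
  ultimately show ?thesis by (simp add: v)
qed

text \<open>Only orderings that list \<open>S - L\<close> before \<open>U - S\<close> feel the
  change. Their numerators change by a multiple of \<open>z (last u) - z (hd v)\<close>, which
  cancels the denominator factor at the junction up to sign, so the sum separates into orderings of
  the two parts.\<close>

lemma order_sum_fun_upd:
  fixes z :: "'a \<Rightarrow> 'k::field"
  assumes "finite U" "inj_on z U" "L \<subset> S" "S \<subset> U"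
    and mono: "\<And>S T. L \<subseteq> S \<Longrightarrow> S \<subseteq> T \<Longrightarrow> T \<subseteq> U \<Longrightarrow> h S \<le> h T"
    and strict: "\<And>T. S \<subset> T \<Longrightarrow> T \<subseteq> U \<Longrightarrow> h S < h T"
  shows "order_sum z (h(S := Suc (h S))) L U =
    order_sum z h L U - order_sum z h L S * order_sum z (h(S := Suc (h S))) S U"
proof -
  let ?h = "h(S := Suc (h S))"
  let ?P = "permutations_of_set (U - L)"
  let ?Q = "permutations_of_set (S - L) \<times> permutations_of_set (U - S)"
  have finS: "finite S" using assms by (auto intro: finite_subset)
  have "order_sum z ?h L U - order_sum z h L U =
      (\<Sum>w\<in>?P. (path_num z ?h L w - path_num z h L w) / path_den z w)"
    by (simp add: order_sum_def sum_subtractf diff_divide_distrib)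
  also have "\<dots> = (\<Sum>w\<in>(\<lambda>(u, v). u @ v) ` ?Q. (path_num z ?h L w - path_num z h L w) / path_den z w)"
  proof (rule sum.mono_neutral_right)
    show "(\<lambda>(u, v). u @ v) ` ?Q \<subseteq> ?P"
      using assms by (auto simp: permutations_of_set_def)
    show "\<forall>w\<in>?P - (\<lambda>(u, v). u @ v) ` ?Q. (path_num z ?h L w - path_num z h L w) / path_den z w = 0"
    proof
      fix w assume w: "w \<in> ?P - (\<lambda>(u, v). u @ v) ` ?Q"
      have "path_num z ?h L w = path_num z h L w"
      proof (rule path_num_fun_upd)
        fix u v assume uv: "w = u @ v"
        show "L \<union> set u \<noteq> S"
        proof
          assume S: "L \<union> set u = S"
          have "distinct (u @ v)" "set u \<union> set v = U - L"
            using w uv by (auto simp: permutations_of_set_def)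
          then have "(u, v) \<in> ?Q" using S by (auto simp: permutations_of_set_def)
          then have "w \<in> (\<lambda>(u, v). u @ v) ` ?Q" unfolding uv by (rule rev_image_eqI) simp
          then show False using w by simp
        qed
      qed
      then show "(path_num z ?h L w - path_num z h L w) / path_den z w = 0" by simp
    qed
  qed simp
  also have "\<dots> = (\<Sum>(u, v)\<in>?Q. (path_num z ?h L (u @ v) - path_num z h L (u @ v)) / path_den z (u @ v))"
  proof (subst sum.reindex)
    show "inj_on (\<lambda>(u, v). u @ v) ?Q"
    proof (rule inj_onI, clarify)
      fix u v u' v'
      assume u: "u \<in> permutations_of_set (S - L)" "u' \<in> permutations_of_set (S - L)"
        and eq: "u @ v = u' @ v'"
      have "length u = length u'" using u by (simp add: length_finite_permutations_of_set)
      then show "u = u' \<and> v = v'" using eq by simp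
    qed
  qed (simp add: case_prod_unfold)
  also have "\<dots> = (\<Sum>(u, v)\<in>?Q. - (path_num z h L u / path_den z u * (path_num z ?h S v / path_den z v)))"
  proof (rule sum.cong[OF refl], clarify)
    fix u v assume u: "u \<in> permutations_of_set (S - L)" and v: "v \<in> permutations_of_set (U - S)"
    have ne: "u \<noteq> []" "v \<noteq> []" and Lu: "L \<union> set u = S" and sv: "set v = U - S"
      and su: "set u = S - L" "distinct u"
      using u v assms(3,4) by (auto simp: permutations_of_set_def)
    have hd: "hd v \<in> U - S" using ne sv by (metis hd_in_set)
    have lst: "last u \<in> S" using ne su by (metis last_in_set DiffD1)
    have "z (hd v) \<noteq> z (last u)"
      using hd lst assms(2,4) by (auto dest: inj_onD)
    moreover have "path_num z ?h L u = z (last u) * path_num z h L u"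
    proof (rule path_num_last_step)
      have "set (butlast u) \<subseteq> set u" by (meson in_set_butlastD subsetI)
      then show "h (L \<union> set (butlast u)) \<le> h S" using Lu assms(4) by (intro mono) auto
    qed (use ne su Lu in auto)
    moreover have "path_num z h S v = z (hd v) * path_num z ?h S v"
      using strict[of "insert (hd v) S"] hd assms(4) ne sv by (intro path_num_first_step) auto
    ultimately have "(path_num z ?h L (u @ v) - path_num z h L (u @ v)) / path_den z (u @ v) =
        (path_num z h L u * path_num z ?h S v * (z (last u) - z (hd v))) /
        (path_den z u * (z (hd v) - z (last u)) * path_den z v)"
      by (simp add: path_num_append path_den_append ne Lu algebra_simps)
    also have "\<dots> = - (path_num z h L u / path_den z u * (path_num z ?h S v / path_den z v))"
      using \<open>z (hd v) \<noteq> z (last u)\<close> by (simp add: divide_simps) (simp add: algebra_simps)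
    finally show "(path_num z ?h L (u @ v) - path_num z h L (u @ v)) / path_den z (u @ v) =
      - (path_num z h L u / path_den z u * (path_num z ?h S v / path_den z v))" .
  qed
  also have "\<dots> = - (order_sum z h L S * order_sum z ?h S U)"
    by (simp add: order_sum_def sum_product sum.cartesian_product sum_negf case_prod_unfold)
  finally show ?thesis by (simp add: algebra_simps)
qed

text \<open>Multiplied by the closing factor, the denominator becomes invariant under cyclic rotation.\<close>

lemma sum_inverse_path_den_eq_0:
  assumes "finite B" "inj_on z B" "card B \<ge> 2"
  shows "(\<Sum>w\<in>permutations_of_set B. 1 / path_den z w) = 0"
proof -
  let ?P = "permutations_of_set B"
  define cyc where "cyc w = path_den z w * (z (hd w) - z (last w))" for w
  have rot: "cyc (rotate1 w) = cyc w" if "length w \<ge> 2" for w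
  proof -
    obtain x v where w: "w = x # v" "v \<noteq> []" using \<open>length w \<ge> 2\<close> by (cases w; cases "tl w") auto
    then have "path_den z w = (z (hd v) - z x) * path_den z v" by (cases v) auto
    with w show ?thesis by (simp add: cyc_def path_den_append)
  qed
  have len: "length w = card B" if "w \<in> ?P" for w
    using that by (rule length_finite_permutations_of_set)
  have bij: "bij_betw rotate1 ?P ?P"
  proof (rule bij_betwI')
    show "rotate1 x = rotate1 y \<longleftrightarrow> x = y" for x y :: "'a list"
      by (metis rotate1_hd_tl rotate1.simps(1) append1_eq_conv list.exhaust_sel rotate1_is_Nil_conv)
    show "rotate1 x \<in> ?P" if "x \<in> ?P" for x using that by (simp add: permutations_of_set_def)
    show "\<exists>x\<in>?P. y = rotate1 x" if y: "y \<in> ?P" for y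
    proof -
      have "y \<noteq> []" using len[OF y] assms(3) by auto
      then have eq: "y = rotate1 (last y # butlast y)" by simp
      moreover have "last y # butlast y \<in> ?P"
        using y eq by (metis (mono_tags, lifting) distinct1_rotate mem_Collect_eq permutations_of_set_def set_rotate1)
      ultimately show ?thesis by blast
    qed
  qed
  \<comment> \<open>Expanding by the closing factor \<open>z (hd w) - z (last w)\<close> splits each
    term in two. Rotation turns \<open>last\<close> into \<open>hd\<close> and preserves
    \<open>cyc\<close>, so the two resulting sums agree.\<close>
  have "(\<Sum>w\<in>?P. 1 / path_den z w) = (\<Sum>w\<in>?P. z (hd w) / cyc w - z (last w) / cyc w)"
  proof (rule sum.cong[OF refl])
    fix w assume w: "w \<in> ?P"
    have "w \<noteq> []" "distinct w" "set w = B" using w len[OF w] assms(3) by (auto simp: permutations_of_set_def)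
    then have "hd w \<noteq> last w"
      using len[OF w] assms(3) by (cases w) (auto simp: Suc_le_eq)
    with \<open>w \<noteq> []\<close> \<open>set w = B\<close> have "z (hd w) \<noteq> z (last w)"
      using assms(2) by (metis hd_in_set inj_onD last_in_set)
    then show "1 / path_den z w = z (hd w) / cyc w - z (last w) / cyc w"
      by (simp add: cyc_def flip: diff_divide_distrib)
  qed
  also have "\<dots> = (\<Sum>w\<in>?P. z (hd w) / cyc w) - (\<Sum>w\<in>?P. z (last w) / cyc w)"
    by (rule sum_subtractf)
  also have "(\<Sum>w\<in>?P. z (last w) / cyc w) = (\<Sum>w\<in>?P. z (last (rotate1 w)) / cyc (rotate1 w))"
    by (rule sum.reindex_bij_betw[OF bij, symmetric])
  also have "\<dots> = (\<Sum>w\<in>?P. z (hd w) / cyc w)"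
  proof (rule sum.cong[OF refl])
    fix w assume w: "w \<in> ?P"
    have "length w \<ge> 2" using len[OF w] assms(3) by simp
    moreover from this have "last (rotate1 w) = hd w" by (cases w) auto
    ultimately show "z (last (rotate1 w)) / cyc (rotate1 w) = z (hd w) / cyc w" by (simp add: rot)
  qed
  finally show ?thesis by simp
qed

section \<open>Heights that depend on one element only\<close>

lemma path_num_modular:
  assumes "e \<notin> S" "distinct w" "set w \<inter> S = {}"
    and "\<And>T. S \<subseteq> T \<Longrightarrow> T \<subseteq> S \<union> set w \<Longrightarrow> h T = c + (if e \<in> T then d else 0)"
  shows "path_num z h S w = (if e \<in> set w then z e ^ d else 1)"
proof -
  have "path_num z (\<lambda>T. c + (if e \<in> T then d else 0)) S w =
      (if e \<in> set w \<and> e \<notin> S then z e ^ d else 1)"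
    using assms(2,3)
  proof (induction w arbitrary: S)
    case (Cons x w)
    then have "path_num z (\<lambda>T. c + (if e \<in> T then d else 0)) (insert x S) w =
      (if e \<in> set w \<and> e \<notin> insert x S then z e ^ d else 1)"
      by (intro Cons.IH) auto
    with Cons.prems show ?case by auto
  qed simp
  moreover have "path_num z h S w = path_num z (\<lambda>T. c + (if e \<in> T then d else 0)) S w"
    by (rule path_num_cong) (rule assms(4))
  ultimately show ?thesis using assms(1) by simp
qed

text \<open>Only the step that adds \<open>e\<close> raises \<open>h\<close>, so every ordering has
  the same numerator \<open>z e ^ d\<close>, and the vanishing sum of inverse denominators
  remains.\<close>

lemma order_sum_modular:
  assumes "finite U" "inj_on z U" "L \<subseteq> U" "e \<in> U - L" "card (U - L) \<ge> 2"
    and "\<And>T. L \<subseteq> T \<Longrightarrow> T \<subseteq> U \<Longrightarrow> h T = c + (if e \<in> T then d else 0)"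
  shows "order_sum z h L U = 0"
proof -
  have "order_sum z h L U = (\<Sum>w\<in>permutations_of_set (U - L). z e ^ d * (1 / path_den z w))"
    unfolding order_sum_def
  proof (rule sum.cong[OF refl])
    fix w assume "w \<in> permutations_of_set (U - L)"
    then have w: "distinct w" "set w = U - L" by (auto simp: permutations_of_set_def)
    then have "path_num z h L w = z e ^ d"
      using path_num_modular[of e L w h c d z] assms(3,4,6) by (simp add: Un_absorb1 Int_commute)
    then show "path_num z h L w / path_den z w = z e ^ d * (1 / path_den z w)" by simp
  qed
  also have "\<dots> = z e ^ d * (\<Sum>w\<in>permutations_of_set (U - L). 1 / path_den z w)"
    by (rule sum_distrib_left[symmetric])
  also have "\<dots> = 0"
    using sum_inverse_path_den_eq_0[of "U - L" z] assms(1,2,5) by (simp add: inj_on_diff)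
  finally show ?thesis .
qed

text \<open>An order sum is homogeneous of degree \<open>h U - h L + 1 - card (U - L)\<close>; its value is described
  for negative degree and for degree \<open>0\<close>.\<close>

definition order_sum_value :: "('a \<Rightarrow> 'k::field) \<Rightarrow> ('a set \<Rightarrow> nat) \<Rightarrow> 'a set \<Rightarrow> 'a set \<Rightarrow> bool" where
  "order_sum_value z h L U \<longleftrightarrow>
    (h U - h L + 1 < card (U - L) \<longrightarrow> order_sum z h L U = 0) \<and>
    (h U - h L + 1 = card (U - L) \<longrightarrow>
      order_sum z h L U = - of_int (chain_mu {T. h L + card (T - L) \<le> h T} L U))"

text \<open>The product in \<open>order_sum_fun_upd\<close> is matched with the product in
  \<open>chain_mu_insert\<close>. When the total degree is 0, the set \<open>S\<close> enters the
  family exactly if both factors have degree 0.\<close>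

lemma order_sum_value_fun_upd:
  fixes z :: "'a \<Rightarrow> 'k::field"
  assumes fin: "finite U" and inj: "inj_on z U" and S: "L \<subset> S" "S \<subset> U"
    and mono: "\<And>S T. L \<subseteq> S \<Longrightarrow> S \<subseteq> T \<Longrightarrow> T \<subseteq> U \<Longrightarrow> h S \<le> h T"
    and strict: "\<And>T. S \<subset> T \<Longrightarrow> T \<subseteq> U \<Longrightarrow> h S < h T"
    and lower: "order_sum_value z h L S"
    and upper: "order_sum_value z (h(S := Suc (h S))) S U"
  shows "order_sum_value z (h(S := Suc (h S))) L U \<longleftrightarrow> order_sum_value z h L U"
proof -
  let ?h = "h(S := Suc (h S))"
  let ?A = "{T. h L + card (T - L) \<le> h T}"
  let ?A' = "{T. ?h L + card (T - L) \<le> ?h T}"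
  have card: "card (U - L) = card (S - L) + card (U - S)"
    using fin S finite_subset[of S U]
    by (subst card_Un_disjoint[symmetric]) (auto intro!: arg_cong[where f = card])
  have h: "h L \<le> h S" "h S < h U" using mono[of L S] strict[of U] S by auto
  have h': "?h U = h U" "?h L = h L" "?h S = Suc (h S)" using S by auto
  have diff: "order_sum z ?h L U = order_sum z h L U - order_sum z h L S * order_sum z ?h S U"
    by (rule order_sum_fun_upd[where h = h, OF fin inj S mono strict])
  show ?thesis
  proof (cases "h U - h L + 1 = card (U - L) \<and> h S - h L + 1 = card (S - L)")
    case True
    then have "Suc (h S) = h L + card (S - L)" "h U - Suc (h S) + 1 = card (U - S)"
      using card h by linarith+
    \<comment> \<open>The lower factor has degree 0, so \<open>h S\<close> is one short of the
      threshold \<open>h L + card (S - L)\<close>, and the raise puts \<open>S\<close> into the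
      family.\<close>
    then have "S \<notin> ?A" "?A' = insert S ?A" using S by auto
    \<comment> \<open>As \<open>?h S\<close> equals that threshold, membership measured from
      \<open>S\<close> agrees with membership measured from \<open>L\<close>.\<close>
    have "chain_mu {T. ?h S + card (T - S) \<le> ?h T} S U = chain_mu ?A S U"
    proof (rule chain_mu_cong[OF fin])
      fix T assume T: "S \<subset> T" "T \<subset> U"
      have "card (T - L) = card (S - L) + card (T - S)"
        using fin T S finite_subset[of S U] finite_subset[of T U]
        by (subst card_Un_disjoint[symmetric]) (auto intro!: arg_cong[where f = card])
      then show "T \<in> {T. ?h S + card (T - S) \<le> ?h T} \<longleftrightarrow> T \<in> ?A"
        using T \<open>Suc (h S) = h L + card (S - L)\<close> by auto
    qed
    then have "order_sum z ?h S U = - of_int (chain_mu ?A S U)"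
      using upper \<open>h U - Suc (h S) + 1 = card (U - S)\<close>
      by (simp only: order_sum_value_def h')
    moreover have "order_sum z h L S = - of_int (chain_mu ?A L S)"
      using lower True by (simp add: order_sum_value_def)
    moreover have "chain_mu ?A' L U = chain_mu ?A L U + chain_mu ?A L S * chain_mu ?A S U"
      unfolding \<open>?A' = insert S ?A\<close> using fin \<open>S \<notin> ?A\<close> S by (rule chain_mu_insert)
    ultimately show ?thesis
      unfolding order_sum_value_def diff h'(1,2)
      using True unfolding h'(1,2) by (simp add: algebra_simps)
  next
    case False
    show ?thesis
    proof (cases "h U - h L + 1 \<le> card (U - L)")
      case True
      \<comment> \<open>The two degrees add up to at most 0 and are not both 0, so one of them is
        negative.\<close>
      have "order_sum z h L S * order_sum z ?h S U = 0"
      proof (cases "h S - h L + 1 < card (S - L)")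
        case True
        then show ?thesis using lower by (simp add: order_sum_value_def)
      next
        case ge: False
        then have "h U - Suc (h S) + 1 < card (U - S)"
          using True False card h by linarith
        then show ?thesis
          using upper by (simp only: order_sum_value_def h' mult_zero_right simp_thms)
      qed
      moreover have "?A' = ?A" if "h U - h L + 1 = card (U - L)"
        using that False h S by auto
      ultimately show ?thesis unfolding order_sum_value_def diff h'(1,2) by auto
    next
      case False
      then show ?thesis unfolding order_sum_value_def h'(1,2) by simp
    qed
  qed
qed

text \<open>If at least two elements are to be added, both sides vanish: in degree 0 the members
  strictly between \<open>L\<close> and \<open>U\<close> are the sets containing \<open>e\<close>,
  and adding \<open>e\<close> is a closure operator under which \<open>L\<close> is not
  closed.\<close>

lemma order_sum_value_modular:
  fixes z :: "'a \<Rightarrow> 'k::field"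
  assumes fin: "finite U" and inj: "inj_on z U" and LU: "L \<subset> U" and e: "e \<in> U - L"
    and h: "\<And>T. L \<subseteq> T \<Longrightarrow> T \<subseteq> U \<Longrightarrow> h T = h L + (if e \<in> T then d else 0)"
  shows "order_sum_value z h L U"
proof (cases "card (U - L) \<ge> 2")
  case True
  let ?A = "{T. h L + card (T - L) \<le> h T}"
  let ?B = "{T. e \<in> T \<and> L \<subseteq> T \<and> T \<subset> U}"
  have zero: "order_sum z h L U = 0"
    by (rule order_sum_modular[OF fin inj _ e True h]) (use LU in auto)
  have "chain_mu ?A L U = 0" if "h U - h L + 1 = card (U - L)"
  proof -
    have "chain_mu ?A L U = chain_mu ?B L U"
    proof (rule chain_mu_cong[OF fin])
      fix T assume T: "L \<subset> T" "T \<subset> U"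
      have "card (T - L) < card (U - L)" using fin T by (intro psubset_card_mono) auto
      moreover have "card (T - L) > 0" using T fin finite_subset by (fastforce simp: card_gt_0_iff)
      moreover have "h U = h L + d" using h[of U] LU e by auto
      ultimately show "T \<in> ?A \<longleftrightarrow> T \<in> ?B" using T h[of T] that by auto
    qed
    also have "\<dots> = (if insert e L = L then chain_mu {T \<in> ?B. insert e T = T} L U else 0)"
    proof (rule chain_mu_closure_top[OF fin LU])
      have "insert e L \<noteq> U"
      proof
        assume "insert e L = U"
        then have "U - L = {e}" using e by auto
        then show False using True by simp
      qed
      then show "T \<subseteq> insert e T \<and> insert e (insert e T) = insert e T \<and> insert e T \<in> insert L ?B"
        if "T \<in> insert L ?B" "L \<subseteq> T" "T \<subset> U" for T
        using that e by auto
    qed (use e in auto)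
    also have "\<dots> = 0" using e by auto
    finally show ?thesis .
  qed
  then show ?thesis using zero by (simp add: order_sum_value_def)
next
  case False
  have ne: "card (U - L) > 0" using e fin by (auto simp: card_gt_0_iff)
  with False have "card (U - L) = 1" by linarith
  then have UL: "U - L = {e}" using e by (metis card_1_singletonE singletonD)
  then have "U = insert e L" using LU by auto
  then have "{T. T \<in> insert L A \<and> L \<subseteq> T \<and> T \<subset> U} = {L}" for A using e by auto
  then have "chain_mu A L U = - 1" for A
    using fin LU finite_subset[of L U] by (simp add: chain_mu_rec chain_mu_self psubset_eq)
  \<comment> \<open>In degree 0 this exponent is 0, so the order sum is 1, the negative of the
    Moebius value of a single step.\<close>
  moreover have "order_sum z h L U = z e ^ (h U - h L)"
    unfolding order_sum_def UL by (simp add: \<open>U = insert e L\<close>)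
  ultimately show ?thesis by (simp add: order_sum_value_def UL)
qed

text \<open>Changing \<open>h\<close> by one at a single set changes the order sum by a product of two shorter
  ones, whose degrees add up to the total degree. If that is not positive, then either one factor has negative
  degree and vanishes, or both are constants. So \<open>h\<close> can be moved to a function that depends only
  on the membership of one element.\<close>

lemma order_sum_eval:
  fixes z :: "'a \<Rightarrow> 'k::field"
  assumes "finite U" "inj_on z U" "L \<subset> U"
    and "\<And>S T. L \<subseteq> S \<Longrightarrow> S \<subseteq> T \<Longrightarrow> T \<subseteq> U \<Longrightarrow> h S \<le> h T"
  shows "order_sum_value z h L U"
  using assms
proof (induction "card (U - L)" arbitrary: L U h rule: less_induct)
  case less
  note fin = less.prems(1) and inj = less.prems(2) and LU = less.prems(3)
  obtain e where e: "e \<in> U - L" using LU by auto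
  \<comment> \<open>Both intervals at \<open>S\<close> are shorter, so the outer induction covers
    them: the lower one with \<open>h\<close>, the upper one with the raised function.\<close>
  have upd: "order_sum_value z (h(S := Suc (h S))) L U \<longleftrightarrow> order_sum_value z h L U"
    if S: "L \<subset> S" "S \<subset> U"
      and mono: "\<And>S T. L \<subseteq> S \<Longrightarrow> S \<subseteq> T \<Longrightarrow> T \<subseteq> U \<Longrightarrow> h S \<le> h T"
      and strict: "\<And>T. S \<subset> T \<Longrightarrow> T \<subseteq> U \<Longrightarrow> h S < h T"
    for S and h :: "'a set \<Rightarrow> nat"
  proof (rule order_sum_value_fun_upd[where h = h, OF fin inj S mono strict])
    show "order_sum_value z h L S"
    proof (rule less.hyps)
      show "card (S - L) < card (U - L)" using S fin by (intro psubset_card_mono) auto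
      show "h X \<le> h Y" if "L \<subseteq> X" "X \<subseteq> Y" "Y \<subseteq> S" for X Y
        using that S by (intro mono) auto
    qed (use S fin inj in \<open>auto intro: finite_subset inj_on_subset\<close>)
    show "order_sum_value z (h(S := Suc (h S))) S U"
    proof (rule less.hyps)
      show "card (U - S) < card (U - L)" using S fin by (intro psubset_card_mono) auto
      have "L \<subseteq> S" using S by blast
      show "(h(S := Suc (h S))) X \<le> (h(S := Suc (h S))) Y" if "S \<subseteq> X" "X \<subseteq> Y" "Y \<subseteq> U" for X Y
        using that \<open>L \<subseteq> S\<close> mono[of X Y] strict[of Y] subset_trans[of L S X]
        by (cases "X = S"; cases "Y = S") (simp_all add: psubset_eq Suc_le_eq)
    qed (use S fin inj in auto)
  qed
  let ?Int = "{T. L \<subseteq> T \<and> T \<subseteq> U}"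
  have finInt: "finite ?Int" using fin by (auto intro: finite_subset[of _ "Pow U"])
  \<comment> \<open>\<open>\<Phi>\<close> is the distance of \<open>h\<close> from the function that
    equals \<open>h U\<close> on sets containing \<open>e\<close> and \<open>h L\<close> on the
    others.\<close>
  define \<Phi> where "\<Phi> h = (\<Sum>T\<in>?Int. if e \<in> T then h U - h T else h T - h L)" for h :: "'a set \<Rightarrow> nat"
  have \<Phi>_less: "\<Phi> h' < \<Phi> h"
    if "L \<subset> S" "S \<subset> U" "\<And>T. T \<noteq> S \<Longrightarrow> h' T = h T"
      and "(if e \<in> S then h U - h' S else h' S - h L) < (if e \<in> S then h U - h S else h S - h L)"
    for h h' S
  proof -
    have hLU: "h' L = h L" "h' U = h U" using that(1-3) by auto
    show ?thesis unfolding \<Phi>_def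
    proof (rule sum_strict_mono_ex1[OF finInt])
      show "\<forall>T\<in>?Int. (if e \<in> T then h' U - h' T else h' T - h' L) \<le> (if e \<in> T then h U - h T else h T - h L)"
      proof
        fix T
        show "(if e \<in> T then h' U - h' T else h' T - h' L) \<le> (if e \<in> T then h U - h T else h T - h L)"
          using that(3)[of T] that(4) hLU by (cases "T = S") auto
      qed
      show "\<exists>T\<in>?Int. (if e \<in> T then h' U - h' T else h' T - h' L) < (if e \<in> T then h U - h T else h T - h L)"
        using that(1,2,4) hLU by (intro bexI[of _ S]) auto
    qed
  qed
  show ?case
    using less.prems(4)
  proof (induction "\<Phi> h" arbitrary: h rule: less_induct)
    case (less h)
    note mono = less.prems
    show ?case
    proof (cases "\<exists>T\<in>?Int. e \<in> T \<and> h T < h U")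
      case True
      let ?X = "{T \<in> ?Int. e \<in> T \<and> h T < h U}"
      have "finite ?X" "?X \<noteq> {}" using True by (auto intro: rev_finite_subset[OF finInt])
      \<comment> \<open>Maximality forces the value \<open>h U\<close> on all larger sets, which
        gives the strictness that \<open>upd\<close> requires and keeps the raised function
        monotone.\<close>
      from finite_has_maximal[OF this] obtain S
        where S: "S \<in> ?X" and max: "\<forall>T\<in>?X. S \<subseteq> T \<longrightarrow> S = T"
        by (rule bexE)
      have SLU: "L \<subset> S" "S \<subset> U" using S e by auto
      have strict: "h S < h T" if "S \<subset> T" "T \<subseteq> U" for T
      proof -
        have "T \<notin> ?X" using bspec[OF max, of T] that(1) by blast
        moreover have "L \<subseteq> T" "e \<in> T" "h S < h U" using that(1) S by blast+
        ultimately show ?thesis using that(2) by simp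
      qed
      have "order_sum_value z (h(S := Suc (h S))) L U"
      proof (rule less.hyps)
        show "\<Phi> (h(S := Suc (h S))) < \<Phi> h"
          by (rule \<Phi>_less[OF SLU]) (use S in auto)
        show "(h(S := Suc (h S))) X \<le> (h(S := Suc (h S))) Y" if "L \<subseteq> X" "X \<subseteq> Y" "Y \<subseteq> U" for X Y
          using that mono[of X Y] strict[of Y] by (cases "X = S"; cases "Y = S") (simp_all add: psubset_eq Suc_le_eq)
      qed
      then show ?thesis using upd[where h = h, OF SLU mono strict] by simp
    next
      case top: False
      show ?thesis
      proof (cases "\<exists>T\<in>?Int. e \<notin> T \<and> h L < h T")
        case True
        let ?X = "{T \<in> ?Int. e \<notin> T \<and> h L < h T}"
        have "finite ?X" "?X \<noteq> {}" using True by (auto intro: rev_finite_subset[OF finInt])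
        \<comment> \<open>Here the value at \<open>S\<close> is lowered, and minimality preserves
          monotonicity. Then \<open>upd\<close> applies to the lowered function, whose raise at
          \<open>S\<close> is \<open>h\<close> again.\<close>
        from finite_has_minimal[OF this] obtain S
          where S: "S \<in> ?X" and min: "\<forall>T\<in>?X. T \<subseteq> S \<longrightarrow> S = T"
          by (rule bexE)
        have SLU: "L \<subset> S" "S \<subset> U" using S e by auto
        let ?h = "h(S := h S - 1)"
        have strict: "h X < h S" if "X \<subset> S" "L \<subseteq> X" for X
        proof -
          have "X \<notin> ?X" using bspec[OF min, of X] that(1) by blast
          moreover have "X \<subseteq> U" "e \<notin> X" "h L < h S" using that(1) S by blast+
          ultimately show ?thesis using that(2) by simp
        qed
        have mono': "?h X \<le> ?h Y" if "L \<subseteq> X" "X \<subseteq> Y" "Y \<subseteq> U" for X Y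
          using that mono[of X Y] strict[of X] by (cases "X = S"; cases "Y = S") (simp_all add: psubset_eq Suc_le_eq)
        have "order_sum_value z ?h L U"
        proof (rule less.hyps)
          show "\<Phi> ?h < \<Phi> h"
            by (rule \<Phi>_less[OF SLU]) (use S in auto)
        qed (rule mono')
        moreover have "order_sum_value z (?h(S := Suc (?h S))) L U \<longleftrightarrow> order_sum_value z ?h L U"
        proof (rule upd[OF SLU])
          show "?h S < ?h T" if "S \<subset> T" "T \<subseteq> U" for T
            using that SLU mono[of S T] S by auto
        qed (rule mono')
        moreover have "?h(S := Suc (?h S)) = h" using S by auto
        ultimately show ?thesis by (simp only:)
      next
        case False
        have "h T = h L + (if e \<in> T then h U - h L else 0)" if "L \<subseteq> T" "T \<subseteq> U" for T
          using that False top mono[of L T] mono[of T U] by (auto simp: not_less)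
        then show ?thesis by (rule order_sum_value_modular[OF fin inj LU e])
      qed
    qed
  qed
qed

section \<open>Rank and closure in a matroid\<close>

context matroid
begin

abbreviation rk :: "'a set \<Rightarrow> nat" where "rk \<equiv> mat_rank I"

lemma finite_indep_subsets: "finite {X \<in> I. X \<subseteq> S}"
  using indep_subset finite_ground by (auto intro: finite_subset[of _ "Pow E"])

lemma indep_finite: "X \<in> I \<Longrightarrow> finite X"
  using indep_subset finite_ground finite_subset by blast

lemma rank_ge: "X \<in> I \<Longrightarrow> X \<subseteq> S \<Longrightarrow> card X \<le> rk S"
  unfolding mat_rank_def using finite_indep_subsets by (intro Max_ge) auto

lemma rank_witness: obtains X where "X \<in> I" "X \<subseteq> S" "card X = rk S"
proof -
  have "rk S \<in> card ` {X \<in> I. X \<subseteq> S}"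
    unfolding mat_rank_def using finite_indep_subsets indep_empty by (intro Max_in) auto
  then show ?thesis using that by auto
qed

lemma rank_mono: "S \<subseteq> T \<Longrightarrow> rk S \<le> rk T"
proof (rule rank_witness[of S])
  fix X assume "S \<subseteq> T" "X \<in> I" "X \<subseteq> S" "card X = rk S"
  then show "rk S \<le> rk T" using rank_ge[of X T] by auto
qed

lemma rank_le_card: "finite S \<Longrightarrow> rk S \<le> card S"
proof (rule rank_witness[of S])
  fix X assume "finite S" "X \<subseteq> S" "card X = rk S"
  then show "rk S \<le> card S" using card_mono[of S X] by simp
qed

lemma rank_empty: "rk {} = 0"
  using rank_le_card[of "{}"] by simp

lemma rank_insert_le: "rk (insert x S) \<le> Suc (rk S)"
proof (rule rank_witness[of "insert x S"])
  fix X assume X: "X \<in> I" "X \<subseteq> insert x S" "card X = rk (insert x S)"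
  have "card (X - {x}) \<le> rk S" using X indep_down[of X "X - {x}"] by (intro rank_ge) auto
  moreover have "card X \<le> Suc (card (X - {x}))"
    using indep_finite[OF X(1)] by (cases "x \<in> X") (simp_all add: card_Suc_Diff1)
  ultimately show ?thesis using X by simp
qed

lemma indep_extend:
  assumes "X \<in> I" "X \<subseteq> S"
  obtains Y where "Y \<in> I" "X \<subseteq> Y" "Y \<subseteq> S" "card Y = rk S"
proof -
  have "\<exists>Y. Y \<in> I \<and> X \<subseteq> Y \<and> Y \<subseteq> S \<and> card Y = rk S"
    using assms
  proof (induction "rk S - card X" arbitrary: X rule: less_induct)
    case less
    show ?case
    proof (cases "card X < rk S")
      case True
      obtain Z where Z: "Z \<in> I" "Z \<subseteq> S" "card Z = rk S" by (rule rank_witness)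
      with True indep_augment[of X Z] less.prems obtain y where y: "y \<in> Z - X" "insert y X \<in> I" by auto
      then have "card (insert y X) = Suc (card X)" using indep_finite[OF less.prems(1)] by simp
      then have "\<exists>Y. Y \<in> I \<and> insert y X \<subseteq> Y \<and> Y \<subseteq> S \<and> card Y = rk S"
        using y Z(2) less.prems True by (intro less.hyps) auto
      then show ?thesis by blast
    next
      case False
      then show ?thesis using rank_ge[OF less.prems] less.prems by (intro exI[of _ X]) auto
    qed
  qed
  then show ?thesis using that by blast
qed

lemma rank_insert_indep:
  assumes "X \<in> I" "X \<subseteq> S" "card X = rk S" "insert x X \<in> I" "x \<notin> X"
  shows "rk (insert x S) = Suc (rk S)"
proof -
  have "Suc (card X) \<le> rk (insert x S)"
    using rank_ge[of "insert x X" "insert x S"] assms indep_finite by auto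
  with assms(3) rank_insert_le[of x S] show ?thesis by simp
qed

text \<open>If \<open>x\<close> raised the rank of \<open>T\<close>, a maximal independent subset
  \<open>X\<close> of \<open>S\<close> could be extended first within \<open>T\<close> and then by
  \<open>x\<close>. So \<open>insert x X\<close> would be independent and \<open>x\<close> would
  raise the rank of \<open>S\<close> as well.\<close>

lemma rank_insert_mono:
  assumes "S \<subseteq> T" "rk (insert x S) = rk S"
  shows "rk (insert x T) = rk T"
proof (rule ccontr)
  assume ne: "rk (insert x T) \<noteq> rk T"
  then have xT: "x \<notin> T" by (metis insert_absorb)
  obtain X where X: "X \<in> I" "X \<subseteq> S" "card X = rk S" by (rule rank_witness)
  obtain Y where Y: "Y \<in> I" "X \<subseteq> Y" "Y \<subseteq> T" "card Y = rk T"
    using X assms(1) by (blast elim: indep_extend)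
  obtain Z where Z: "Z \<in> I" "Y \<subseteq> Z" "Z \<subseteq> insert x T" "card Z = rk (insert x T)"
    using Y by (blast elim: indep_extend)
  have "\<not> Z \<subseteq> T" using ne Z rank_ge[of Z T] rank_mono[OF subset_insertI, of T x] by auto
  then have "insert x X \<subseteq> Z" using Z(2,3) Y(2) by auto
  then have "insert x X \<in> I" using Z(1) indep_down by blast
  moreover have "x \<notin> X" using X(2) assms(1) xT by auto
  ultimately show False using rank_insert_indep[OF X] assms(2) by simp
qed

lemma rank_Un_closure:
  assumes "finite X" "\<And>x. x \<in> X \<Longrightarrow> rk (insert x S) = rk S"
  shows "rk (S \<union> X) = rk S"
  using assms
proof (induction X rule: finite_induct)
  case (insert x X)
  have "rk (insert x (S \<union> X)) = rk (S \<union> X)"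
    by (rule rank_insert_mono[OF Un_upper1]) (rule insert.prems, rule insertI1)
  also have "\<dots> = rk S" by (rule insert.IH) (rule insert.prems, rule insertI2)
  finally show ?case by (simp only: Un_insert_right)
qed simp

section \<open>The closure operator\<close>

abbreviation cl :: "'a set \<Rightarrow> 'a set" where "cl \<equiv> mat_closure E I"

lemma closure_subset: "cl S \<subseteq> E"
  by (auto simp: mat_closure_def)

lemma closure_extensive: "S \<subseteq> E \<Longrightarrow> S \<subseteq> cl S"
  by (auto simp: mat_closure_def insert_absorb)

lemma closure_mono: "S \<subseteq> T \<Longrightarrow> cl S \<subseteq> cl T"
  unfolding mat_closure_def by (intro Collect_mono) (blast intro: rank_insert_mono)

lemma rank_closure:
  assumes "S \<subseteq> E"
  shows "rk (cl S) = rk S"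
proof -
  have "rk (S \<union> cl S) = rk S"
  proof (rule rank_Un_closure)
    show "finite (cl S)" using closure_subset finite_ground by (rule finite_subset)
    show "\<And>x. x \<in> cl S \<Longrightarrow> rk (insert x S) = rk S" by (simp add: mat_closure_def)
  qed
  then show ?thesis by (simp only: Un_absorb1[OF closure_extensive[OF assms]])
qed

lemma closure_idem:
  assumes "S \<subseteq> E"
  shows "cl (cl S) = cl S"
proof
  show "cl (cl S) \<subseteq> cl S"
  proof
    fix x assume x: "x \<in> cl (cl S)"
    then have "rk (insert x (cl S)) = rk S"
      using rank_closure[OF assms] by (simp add: mat_closure_def)
    moreover have "rk (insert x S) \<le> rk (insert x (cl S))"
      using closure_extensive[OF assms] by (intro rank_mono) auto
    moreover have "rk S \<le> rk (insert x S)" by (rule rank_mono) auto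
    ultimately show "x \<in> cl S" using x by (auto simp: mat_closure_def)
  qed
qed (use closure_extensive closure_subset in auto)

lemma closure_ground: "cl E = E"
  using closure_subset closure_extensive by auto

section \<open>Loops and coloops\<close>

lemma loop_rank_insert:
  assumes "mat_loop E I e"
  shows "rk (insert e S) = rk S"
proof (rule antisym)
  show "rk (insert e S) \<le> rk S"
  proof (rule rank_witness[of "insert e S"])
    fix X assume X: "X \<in> I" "X \<subseteq> insert e S" "card X = rk (insert e S)"
    then have "e \<notin> X" using assms indep_down[of X "{e}"] by (auto simp: mat_loop_def)
    then show ?thesis using X rank_ge[of X S] by auto
  qed
qed (rule rank_mono, auto)

lemma loopless_closure_empty:
  assumes "\<forall>e\<in>E. \<not> mat_loop E I e"
  shows "cl {} = {}"
proof -
  have "rk {e} \<noteq> 0" if "e \<in> E" for e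
    using that assms rank_ge[of "{e}" "{e}"] by (auto simp: mat_loop_def)
  then show ?thesis by (auto simp: mat_closure_def rank_empty)
qed

lemma basis_iff: "mat_basis I B \<longleftrightarrow> B \<in> I \<and> card B = rk E"
proof
  assume B: "mat_basis I B"
  then have "B \<in> I" "B \<subseteq> E" using indep_subset by (auto simp: mat_basis_def)
  then obtain Y where "Y \<in> I" "B \<subseteq> Y" "card Y = rk E" by (blast elim: indep_extend)
  then show "B \<in> I \<and> card B = rk E" using B by (auto simp: mat_basis_def)
next
  assume B: "B \<in> I \<and> card B = rk E"
  have "X = B" if "X \<in> I" "B \<subseteq> X" for X
    using that B rank_ge[of X E] indep_subset[of X] indep_finite[of X] card_seteq[of X B] by auto
  then show "mat_basis I B" using B by (auto simp: mat_basis_def)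
qed

text \<open>A maximal independent subset of \<open>S\<close> extends to a basis. That basis contains
  \<open>e\<close>, so the subset stays independent when \<open>e\<close> is added.\<close>

lemma coloop_rank_insert:
  assumes "mat_coloop E I e" "S \<subseteq> E" "e \<notin> S"
  shows "rk (insert e S) = Suc (rk S)"
proof -
  obtain X where X: "X \<in> I" "X \<subseteq> S" "card X = rk S" by (rule rank_witness)
  obtain B where B: "B \<in> I" "X \<subseteq> B" "card B = rk E"
    using X assms(2) by (metis indep_extend subset_trans)
  then have "e \<in> B" using assms(1) basis_iff by (auto simp: mat_coloop_def)
  then have "insert e X \<in> I" using B indep_down by (metis insert_subset)
  then show ?thesis using rank_insert_indep[OF X] assms(3) X(2) by auto
qed

lemma not_coloop_rank:
  assumes "e \<in> E" "\<not> mat_coloop E I e"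
  shows "rk (E - {e}) = rk E"
proof -
  obtain B where B: "B \<in> I" "card B = rk E" "e \<notin> B"
    using assms basis_iff by (auto simp: mat_coloop_def)
  then have "B \<subseteq> E - {e}" using indep_subset by blast
  with B have "rk E \<le> rk (E - {e})" using rank_ge by metis
  then show ?thesis using rank_mono[of "E - {e}" E] by auto
qed

section \<open>Nullity\<close>

abbreviation nullity :: "'a set \<Rightarrow> nat" where "nullity S \<equiv> card S - rk S"

lemma nullity_insert:
  assumes "finite S" "x \<notin> S"
  shows "nullity (insert x S) = (if rk S < rk (insert x S) then nullity S else Suc (nullity S))"
proof -
  have "rk (insert x S) = rk S \<or> rk (insert x S) = Suc (rk S)"
    using rank_insert_le[of x S] rank_mono[OF subset_insertI, of S x] by auto
  moreover have "rk S \<le> card S" by (rule rank_le_card[OF assms(1)])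
  ultimately show ?thesis using assms by auto
qed

lemma nullity_mono:
  assumes "finite T" "S \<subseteq> T"
  shows "nullity S \<le> nullity T"
proof -
  have "finite S" using assms finite_subset by blast
  have "finite X \<Longrightarrow> nullity S \<le> nullity (S \<union> X)" for X
  proof (induction X rule: finite_induct)
    case (insert x X)
    have "nullity (S \<union> X) \<le> nullity (insert x (S \<union> X))"
    proof (cases "x \<in> S \<union> X")
      case False
      then show ?thesis using nullity_insert[of "S \<union> X" x] \<open>finite S\<close> insert by simp
    qed (simp add: insert_absorb)
    with insert show ?case by simp
  qed simp
  from this[of T] show ?thesis using assms by (simp add: Un_absorb1)
qed

end

section \<open>Ferroni paths and elementary symmetric polynomials\<close>

text \<open>A Ferroni path is encoded by the set of the indices, counted from \<open>0\<close>, of its diagonal steps.\<close>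

definition diag_sets :: "nat \<Rightarrow> nat \<Rightarrow> nat set set" where
  "diag_sets n r = {Q. Q \<subseteq> {..<n - r - 1} \<and> card Q = r - 1}"

definition path_of :: "nat \<Rightarrow> nat set \<Rightarrow> (rat \<times> rat) list" where
  "path_of m Q = map (\<lambda>i. if i \<in> Q then (1, 1) else (1, 0)) [0..<m]"

lemma finite_diag_sets: "finite (diag_sets n r)"
  by (rule finite_subset[of _ "Pow {..<n - r - 1}"]) (auto simp: diag_sets_def)

lemma length_path_of: "length (path_of m Q) = m"
  by (simp add: path_of_def)

lemma take_path_of: "take k (path_of m Q) = path_of (min k m) Q"
  by (simp add: path_of_def take_map min_def)

lemma count_path_of: "count_list (path_of m Q) (1, 1) = card (Q \<inter> {..<m})"
proof (induction m)
  case (Suc m)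
  have "Q \<inter> {..<Suc m} = (if m \<in> Q then insert m (Q \<inter> {..<m}) else Q \<inter> {..<m})"
    by (auto simp: less_Suc_eq)
  with Suc show ?case by (simp add: path_of_def)
qed (simp add: path_of_def)

lemma weakly_above_path_of:
  assumes "Q \<subseteq> {..<m}"
  shows "weakly_above (path_of m Q) (int a, int b) \<longleftrightarrow> b \<le> card (Q \<inter> {..<a})"
proof -
  have "nat (min (int a) (int m)) = min a m" by simp
  moreover have "Q \<inter> {..<min a m} = Q \<inter> {..<a}" using assms by auto
  ultimately show ?thesis
    by (simp add: weakly_above_def length_path_of take_path_of count_path_of)
qed

lemma sum_list_steps:
  assumes "set P \<subseteq> {(1, 1), (1, 0 :: rat)}"
  shows "sum_list P = (of_nat (length P), of_nat (count_list P (1, 1)))"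
  using assms by (induction P) (auto simp: zero_prod_def)

lemma ferroni_paths_iff:
  assumes "r \<ge> 1" "r < n"
  shows "P \<in> ferroni_paths n r \<longleftrightarrow>
    set P \<subseteq> {(1, 1), (1, 0)} \<and> length P = n - r - 1 \<and> count_list P (1, 1) = r - 1"
proof (cases "set P \<subseteq> {(1, 1), (1, 0)}")
  case True
  have "rat_of_nat (n - r - 1) = of_nat n - of_nat r - 1" "rat_of_nat (r - 1) = of_nat r - 1"
    using assms by (simp_all add: of_nat_diff)
  then have "(1/2 :: rat, 1/2 :: rat) + sum_list P = (of_nat n - of_nat r - 1/2, of_nat r - 1/2) \<longleftrightarrow>
      rat_of_nat (length P) = of_nat (n - r - 1) \<and> rat_of_nat (count_list P (1, 1)) = of_nat (r - 1)"
    unfolding sum_list_steps[OF True] by auto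
  then show ?thesis using True by (simp add: ferroni_paths_def)
qed (simp add: ferroni_paths_def)

text \<open>The endpoint would lie one unit below the start. Rank 0 is kept apart because, with
  truncated subtraction, \<open>diag_sets n 0\<close> contains the empty set.\<close>

lemma ferroni_paths_rank_0: "ferroni_paths n 0 = {}"
proof -
  have "P \<notin> ferroni_paths n 0" for P
  proof
    assume P: "P \<in> ferroni_paths n 0"
    then have "rat_of_nat (count_list P (1, 1)) = - 1"
      using sum_list_steps[of P] by (auto simp: ferroni_paths_def)
    then show False by (metis of_nat_0_le_iff neg_0_le_iff_le not_one_le_zero)
  qed
  then show ?thesis by blast
qed

lemma bij_betw_path_of:
  assumes "r \<ge> 1" "r < n"
  shows "bij_betw (path_of (n - r - 1)) (diag_sets n r) (ferroni_paths n r)"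
proof (rule bij_betw_imageI)
  let ?m = "n - r - 1"
  have nth: "path_of ?m Q ! i = (if i \<in> Q then (1, 1) else (1, 0))" if "i < ?m" for Q i
    using that by (simp add: path_of_def)
  show "inj_on (path_of ?m) (diag_sets n r)"
  proof (rule inj_onI)
    fix Q Q' assume Q: "Q \<in> diag_sets n r" "Q' \<in> diag_sets n r" and eq: "path_of ?m Q = path_of ?m Q'"
    have "i \<in> Q \<longleftrightarrow> i \<in> Q'" if "i < ?m" for i
      using nth[OF that, of Q] nth[OF that, of Q'] eq by (auto split: if_splits)
    then show "Q = Q'" using Q by (auto simp: diag_sets_def)
  qed
  show "path_of ?m ` diag_sets n r = ferroni_paths n r"
  proof (intro equalityI subsetI)
    fix P assume "P \<in> path_of ?m ` diag_sets n r"
    then obtain Q where Q: "Q \<subseteq> {..<?m}" "card Q = r - 1" "P = path_of ?m Q"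
      by (auto simp: diag_sets_def)
    then have "Q \<inter> {..<?m} = Q" by auto
    with Q show "P \<in> ferroni_paths n r"
      by (auto simp: ferroni_paths_iff[OF assms] length_path_of count_path_of) (auto simp: path_of_def)
  next
    fix P assume "P \<in> ferroni_paths n r"
    then have P: "set P \<subseteq> {(1, 1), (1, 0)}" "length P = ?m" "count_list P (1, 1) = r - 1"
      by (auto simp: ferroni_paths_iff[OF assms])
    define Q where "Q = {i. i < ?m \<and> P ! i = (1, 1)}"
    have "P ! i = path_of ?m Q ! i" if "i < ?m" for i
    proof -
      have "P ! i \<in> {(1, 1), (1, 0)}" using that P(1,2) nth_mem[of i P] by (metis subsetD)
      then show ?thesis using that nth[OF that, of Q] by (auto simp: Q_def)
    qed
    then have eq: "P = path_of ?m Q"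
      using P(2) by (intro nth_equalityI) (simp_all add: length_path_of)
    have "Q \<inter> {..<?m} = Q" by (auto simp: Q_def)
    then have "card Q = r - 1" using P(3) count_path_of[of ?m Q] eq by simp
    then have "Q \<in> diag_sets n r" by (auto simp: diag_sets_def Q_def)
    with eq show "P \<in> path_of ?m ` diag_sets n r" by blast
  qed
qed

lemma num_ferroni_above_eq:
  assumes "r \<ge> 1" "r < n" "\<And>p. p \<in> set ps \<Longrightarrow> p = (int (a p), int (b p))"
  shows "num_ferroni_above n r ps =
    card {Q \<in> diag_sets n r. \<forall>p\<in>set ps. b p \<le> card (Q \<inter> {..<a p})}"
proof -
  have bij: "bij_betw (path_of (n - r - 1)) (diag_sets n r) (ferroni_paths n r)"
    by (rule bij_betw_path_of[OF assms(1,2)])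
  have wa: "weakly_above (path_of (n - r - 1) Q) p \<longleftrightarrow> b p \<le> card (Q \<inter> {..<a p})"
    if "Q \<in> diag_sets n r" "p \<in> set ps" for Q p
    using that assms(3)[OF that(2)] weakly_above_path_of[of Q "n - r - 1" "a p" "b p"]
    by (auto simp: diag_sets_def)
  have "{P \<in> ferroni_paths n r. \<forall>p\<in>set ps. weakly_above P p} =
      path_of (n - r - 1) ` {Q \<in> diag_sets n r. \<forall>p\<in>set ps. b p \<le> card (Q \<inter> {..<a p})}"
    (is "?L = ?R")
  proof (intro equalityI subsetI)
    fix P assume P: "P \<in> ?L"
    then obtain Q where "Q \<in> diag_sets n r" "P = path_of (n - r - 1) Q"
      using bij_betw_imp_surj_on[OF bij] by blast
    with P show "P \<in> ?R" using wa by blast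
  next
    fix P assume "P \<in> ?R"
    then show "P \<in> ?L" using wa bij_betw_apply[OF bij] by blast
  qed
  moreover have "inj_on (path_of (n - r - 1)) {Q \<in> diag_sets n r. \<forall>p\<in>set ps. b p \<le> card (Q \<inter> {..<a p})}"
    using bij_betw_imp_inj_on[OF bij] by (rule inj_on_subset) auto
  ultimately show ?thesis by (simp add: num_ferroni_above_def card_image)
qed

section \<open>Elementary symmetric polynomials\<close>

lemma elem_sym_0: "finite A \<Longrightarrow> elem_sym 0 A f = 1"
proof -
  assume "finite A"
  then have "{T. T \<subseteq> A \<and> card T = 0} = {{}}" by (auto dest: finite_subset)
  then show ?thesis by (simp add: elem_sym_def)
qed

lemma elem_sym_card: "finite A \<Longrightarrow> elem_sym (card A) A f = prod f A"
proof -
  assume "finite A"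
  then have "{T. T \<subseteq> A \<and> card T = card A} = {A}" by (auto dest: card_subset_eq)
  then show ?thesis by (simp add: elem_sym_def)
qed

lemma elem_sym_Suc:
  assumes "finite A" "l \<in> A"
  shows "elem_sym (Suc k) A f = elem_sym (Suc k) (A - {l}) f + f l * elem_sym k (A - {l}) f"
proof -
  let ?S = "\<lambda>k. {T. T \<subseteq> A - {l} \<and> card T = k}"
  have fin: "finite (?S k)" for k using assms(1) by (auto intro: finite_subset[of _ "Pow A"])
  have finT: "finite T" if "T \<in> ?S k" for T k
    using that assms(1) by (auto intro: finite_subset)
  have "{T. T \<subseteq> A \<and> card T = Suc k} = ?S (Suc k) \<union> insert l ` ?S k" (is "?L = ?R")
  proof (intro equalityI subsetI)
    fix T assume T: "T \<in> ?L"
    show "T \<in> ?R"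
    proof (cases "l \<in> T")
      case True
      then have "T = insert l (T - {l})" "T - {l} \<in> ?S k"
        using T assms(1) by (auto simp: card_Diff_singleton dest: finite_subset)
      then show ?thesis by blast
    qed (use T in auto)
  next
    fix T assume "T \<in> ?R"
    then consider "T \<in> ?S (Suc k)" | T' where "T' \<in> ?S k" "T = insert l T'" by blast
    then show "T \<in> ?L"
    proof cases
      case 2
      then have "finite T'" "l \<notin> T'" using finT by blast+
      then show ?thesis using 2 assms(2) by auto
    qed auto
  qed
  moreover have "?S (Suc k) \<inter> insert l ` ?S k = {}" by auto
  ultimately have "elem_sym (Suc k) A f = elem_sym (Suc k) (A - {l}) f + (\<Sum>T\<in>insert l ` ?S k. prod f T)"
    unfolding elem_sym_def using fin by (simp add: sum.union_disjoint)
  also have "(\<Sum>T\<in>insert l ` ?S k. prod f T) = (\<Sum>T\<in>?S k. f l * prod f T)"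
  proof (subst sum.reindex)
    show "inj_on (insert l) (?S k)" by (rule inj_onI) blast
    show "sum (prod f \<circ> insert l) (?S k) = (\<Sum>T\<in>?S k. f l * prod f T)"
    proof (rule sum.cong[OF refl])
      fix T assume T: "T \<in> ?S k"
      then have "l \<notin> T" by auto
      then show "(prod f \<circ> insert l) T = f l * prod f T" using finT[OF T] by simp
    qed
  qed
  finally show ?thesis by (simp add: elem_sym_def sum_distrib_left)
qed

text \<open>In generating functions, the product of the \<open>1 + f a * t\<close> over
  \<open>A\<close> is divided by \<open>1 + f l * t\<close>, whose inverse has the coefficients
  \<open>(- f l) ^ j\<close>.\<close>

lemma elem_sym_remove:
  assumes "finite A" "l \<in> A"
  shows "(\<Sum>j\<le>k. (- f l) ^ j * elem_sym (k - j) A f) = elem_sym k (A - {l}) f"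
proof (induction k)
  case 0
  then show ?case using assms by (simp add: elem_sym_0)
next
  case (Suc k)
  have "(\<Sum>j\<le>Suc k. (- f l) ^ j * elem_sym (Suc k - j) A f) =
      elem_sym (Suc k) A f - f l * (\<Sum>j\<le>k. (- f l) ^ j * elem_sym (k - j) A f)"
    by (subst sum.atMost_Suc_shift) (simp add: sum_distrib_left mult.assoc sum_negf)
  then show ?case using Suc elem_sym_Suc[OF assms, of k f] by simp
qed

lemma elem_sym_image:
  assumes "inj_on c A"
  shows "elem_sym k (c ` A) f = elem_sym k A (f \<circ> c)"
proof -
  have "{T. T \<subseteq> c ` A \<and> card T = k} = image c ` {T. T \<subseteq> A \<and> card T = k}" (is "?L = ?R")
  proof (intro equalityI subsetI)
    fix T assume T: "T \<in> ?L"
    then obtain T' where "T' \<subseteq> A" "T = c ` T'" by (auto simp: subset_image_iff)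
    then show "T \<in> ?R" using T assms by (auto simp: card_image inj_on_subset)
  next
    fix T assume "T \<in> ?R"
    then show "T \<in> ?L" using assms by (auto simp: card_image inj_on_subset)
  qed
  moreover have "inj_on (image c) {T. T \<subseteq> A \<and> card T = k}"
    using inj_on_image_Pow[OF assms] by (rule inj_on_subset) auto
  ultimately show ?thesis
    using assms by (auto simp: elem_sym_def sum.reindex prod.reindex inj_on_subset intro!: sum.cong)
qed

lemma zvar_inj: "zvar e = zvar f \<longleftrightarrow> e = f"
proof
  assume "zvar e = zvar f"
  then have "Poly_Mapping.single (Poly_Mapping.single e 1) (1::int) =
      Poly_Mapping.single (Poly_Mapping.single f (1::nat)) 1"
    by (metis zvar.rep_eq)
  then have "Poly_Mapping.single e (1::nat) = Poly_Mapping.single f 1"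
    by (metis keys_single one_neq_zero singleton_inject)
  then show "e = f" by (metis keys_single one_neq_zero singleton_inject)
qed simp

section \<open>The numerators of the localization formula\<close>

lemma path_num_nth:
  "path_num z h S w =
    (\<Prod>k<length w. z (w ! k) ^ (h (S \<union> set (take (Suc k) w)) - h (S \<union> set (take k w))))"
proof (induction w arbitrary: S)
  case (Cons x w)
  show ?case
    by (simp add: Cons.IH prod.lessThan_Suc_shift del: prod.lessThan_Suc)
qed simp

context matroid
begin

text \<open>By \<open>nullity_prefix\<close>, the nullity before a dependent step numbers that step,
  counted from 0. This numbering matches the dependent entries with the steps of a path.\<close>

definition dep_steps :: "'a list \<Rightarrow> nat set" where
  "dep_steps w = {k. k < length w \<and> \<not> rk (set (take k w)) < rk (set (take (Suc k) w))}"

lemma finite_dep_steps: "finite (dep_steps w)"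
  by (rule finite_subset[of _ "{..<length w}"]) (auto simp: dep_steps_def)

lemma Diff_greedy_basis:
  assumes "distinct w"
  shows "set w - greedy_basis I w = (!) w ` dep_steps w"
proof -
  have "w ! k \<in> greedy_basis I w \<longleftrightarrow> k \<notin> dep_steps w" if "k < length w" for k
    using that assms by (auto simp: greedy_basis_def dep_steps_def nth_eq_iff_index_eq)
  moreover have "k < length w" if "k \<in> dep_steps w" for k
    using that by (simp add: dep_steps_def)
  ultimately show ?thesis by (force simp: set_conv_nth)
qed

lemma nullity_Suc_prefix:
  assumes "distinct w" "k < length w"
  shows "nullity (set (take (Suc k) w)) =
    (if k \<in> dep_steps w then Suc (nullity (set (take k w))) else nullity (set (take k w)))"
proof -
  have "w ! k \<notin> set (take k w)"
    using assms by (simp add: distinct_conv_nth in_set_conv_nth)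
  moreover have "set (take (Suc k) w) = insert (w ! k) (set (take k w))"
    using assms(2) by (simp add: take_Suc_conv_app_nth)
  ultimately show ?thesis
    using nullity_insert[of "set (take k w)" "w ! k"] assms(2) by (simp add: dep_steps_def)
qed

lemma nullity_prefix:
  assumes "distinct w" "k \<le> length w"
  shows "nullity (set (take k w)) = card (dep_steps w \<inter> {..<k})"
  using assms(2)
proof (induction k)
  case (Suc k)
  have "dep_steps w \<inter> {..<Suc k} =
      (if k \<in> dep_steps w then insert k (dep_steps w \<inter> {..<k}) else dep_steps w \<inter> {..<k})"
    by (auto simp: less_Suc_eq)
  then show ?case
    using nullity_Suc_prefix[OF assms(1), of k] Suc by simp
qed simp

definition path_height :: "nat set \<Rightarrow> 'a set \<Rightarrow> nat" where
  "path_height Q S = nullity S + card (Q \<inter> {..<nullity S})"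

lemma path_height_mono:
  assumes "finite T" "S \<subseteq> T"
  shows "path_height Q S \<le> path_height Q T"
proof -
  have le: "nullity S \<le> nullity T" by (rule nullity_mono[OF assms])
  then have "card (Q \<inter> {..<nullity S}) \<le> card (Q \<inter> {..<nullity T})"
    by (intro card_mono) auto
  with le show ?thesis unfolding path_height_def by (rule add_mono)
qed

text \<open>An entry of the greedy basis leaves \<open>path_height Q\<close> unchanged. A dependent
  entry raises it by 2 if its number lies in \<open>Q\<close>, and by 1 otherwise; the second
  product collects the additional factors.\<close>

lemma path_num_path_height:
  assumes "distinct w"
  shows "path_num z (path_height Q) {} w =
    (\<Prod>k\<in>dep_steps w. z (w ! k)) *
    (\<Prod>k\<in>{k \<in> dep_steps w. nullity (set (take k w)) \<in> Q}. z (w ! k))"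
proof -
  let ?\<nu> = "\<lambda>k. nullity (set (take k w))"
  have "path_num z (path_height Q) {} w =
      (\<Prod>k<length w. if k \<in> dep_steps w then z (w ! k) * (if ?\<nu> k \<in> Q then z (w ! k) else 1) else 1)"
    unfolding path_num_nth
  proof (rule prod.cong[OF refl])
    fix k assume "k \<in> {..<length w}"
    then have k: "k < length w" by simp
    have "Q \<inter> {..<Suc a} = (if a \<in> Q then insert a (Q \<inter> {..<a}) else Q \<inter> {..<a})" for a
      by (auto simp: less_Suc_eq)
    then have "path_height Q (set (take (Suc k) w)) - path_height Q (set (take k w)) =
        (if k \<in> dep_steps w then (if ?\<nu> k \<in> Q then 2 else 1) else 0)"
      unfolding path_height_def nullity_Suc_prefix[OF assms k] by simp
    then show "z (w ! k) ^ (path_height Q ({} \<union> set (take (Suc k) w)) - path_height Q ({} \<union> set (take k w))) =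
        (if k \<in> dep_steps w then z (w ! k) * (if ?\<nu> k \<in> Q then z (w ! k) else 1) else 1)"
      by (simp add: power2_eq_square)
  qed
  also have "\<dots> = (\<Prod>k\<in>dep_steps w. z (w ! k) * (if ?\<nu> k \<in> Q then z (w ! k) else 1))"
    by (rule prod.mono_neutral_cong_right) (auto simp: dep_steps_def)
  also have "\<dots> = (\<Prod>k\<in>dep_steps w. z (w ! k)) * (\<Prod>k\<in>{k \<in> dep_steps w. ?\<nu> k \<in> Q}. z (w ! k))"
    unfolding prod.distrib prod.inter_filter[OF finite_dep_steps] ..
  finally show ?thesis .
qed

lemma elem_sym_eq_sum_path_num:
  fixes z :: "'a \<Rightarrow> 'k::field"
  assumes w: "w \<in> permutations_of_set E" and ne: "E \<noteq> {}"
    and no_coloop: "\<not> mat_coloop E I (last w)"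
  shows "card (E - greedy_basis I w) = card E - rk E"
    and "last w \<in> E - greedy_basis I w"
    and "elem_sym (rk E - 1) (E - greedy_basis I w - {last w}) z * prod z (E - greedy_basis I w) =
      (\<Sum>Q\<in>diag_sets (card E) (rk E). path_num z (path_height Q) {} w)"
proof -
  let ?n = "card E" and ?r = "rk E" and ?K = "dep_steps w"
  let ?\<nu> = "\<lambda>k. nullity (set (take k w))"
  have dist: "distinct w" and set: "set w = E" and len: "length w = ?n"
    using w by (auto simp: permutations_of_set_def distinct_card)
  have "w \<noteq> []" using set ne by auto
  then have n: "?n > 0" using len by (metis length_greater_0_conv)
  have \<nu>: "?\<nu> k = card (?K \<inter> {..<k})" if "k \<le> ?n" for k
    using nullity_prefix[OF dist, of k] that len by simp
  have K_less: "k < ?n" if "k \<in> ?K" for k using that len by (simp add: dep_steps_def)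
  then have "?K \<inter> {..<?n} = ?K" by auto
  then have cardK: "card ?K = ?n - ?r" using \<nu>[of ?n] set len by simp
  have inj: "inj_on ((!) w) ?K"
    using inj_on_nth[OF dist, of ?K] K_less len by auto
  have C: "E - greedy_basis I w = (!) w ` ?K"
    using Diff_greedy_basis[OF dist] set by simp
  show "card (E - greedy_basis I w) = ?n - ?r"
    unfolding C using card_image[OF inj] cardK by simp
  have last: "last w = w ! (?n - 1)" using \<open>w \<noteq> []\<close> len by (simp add: last_conv_nth)
  \<comment> \<open>The last entry is not a coloop, so the entries before it already have full rank
    and the last position is a dependent step.\<close>
  have "set (take (?n - 1) w) = E - {last w}"
  proof -
    have "w = take (?n - 1) w @ [last w]"
      using \<open>w \<noteq> []\<close> len by (metis append_butlast_last_id butlast_conv_take)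
    then have "distinct (take (?n - 1) w @ [last w])" "E = set (take (?n - 1) w @ [last w])"
      using dist set by metis+
    then show ?thesis by auto
  qed
  moreover have "last w \<in> E" using \<open>w \<noteq> []\<close> set by auto
  ultimately have "rk (set (take (?n - 1) w)) = ?r"
    using not_coloop_rank[OF _ no_coloop] by simp
  then have lastK: "?n - 1 \<in> ?K"
    using n len set by (simp add: dep_steps_def)
  show last_mem: "last w \<in> E - greedy_basis I w" unfolding C last using lastK by simp
  \<comment> \<open>With the last position set aside, \<open>\<nu>\<close> numbers the remaining
    dependent positions by \<open>0, ..., ?m - 1\<close>, as many as a path has steps.\<close>
  define K' where "K' = ?K - {?n - 1}"
  let ?m = "?n - ?r - 1"
  have finK': "finite K'" using finite_dep_steps by (simp add: K'_def)
  have cardK': "card K' = ?m" using cardK lastK finite_dep_steps by (simp add: K'_def)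
  have \<nu>_less: "?\<nu> i < ?\<nu> j" if "i \<in> ?K" "i < j" "j \<le> ?n" for i j
  proof -
    have "?K \<inter> {..<i} \<subset> ?K \<inter> {..<j}" using that by auto
    then have "card (?K \<inter> {..<i}) < card (?K \<inter> {..<j})" by (intro psubset_card_mono) auto
    then show ?thesis using \<nu>[of i] \<nu>[of j] that by simp
  qed
  have inj_\<nu>: "inj_on ?\<nu> ?K"
  proof (rule inj_onI)
    fix i j assume ij: "i \<in> ?K" "j \<in> ?K" "?\<nu> i = ?\<nu> j"
    show "i = j"
      using \<nu>_less[of i j] \<nu>_less[of j i] ij K_less[of i] K_less[of j]
      by (metis less_imp_le less_irrefl linorder_neqE_nat)
  qed
  have "?K \<inter> {..<?n - 1} = K'" using K_less unfolding K'_def by fastforce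
  then have \<nu>_last: "?\<nu> (?n - 1) = ?m" using \<nu>[of "?n - 1"] cardK' by simp
  have "?\<nu> ` K' \<subseteq> {..<?m}"
  proof (rule image_subsetI)
    fix k assume k: "k \<in> K'"
    then have "k \<in> ?K" "k < ?n - 1" using K_less[of k] by (auto simp: K'_def)
    then show "?\<nu> k \<in> {..<?m}" using \<nu>_less[of k "?n - 1"] \<nu>_last by simp
  qed
  moreover have inj_\<nu>': "inj_on ?\<nu> K'" using inj_\<nu> by (rule inj_on_subset) (auto simp: K'_def)
  ultimately have \<nu>K': "?\<nu> ` K' = {..<?m}"
    using cardK' by (intro card_subset_eq) (auto simp: card_image)
  define \<sigma> where "\<sigma> = inv_into K' ?\<nu>"
  have \<sigma>: "bij_betw \<sigma> {..<?m} K'"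
    unfolding \<sigma>_def using inj_\<nu>' \<nu>K' by (intro bij_betw_inv_into) (simp add: bij_betw_def)
  have \<nu>\<sigma>: "?\<nu> (\<sigma> i) = i" if "i < ?m" for i
    unfolding \<sigma>_def using \<nu>K' that by (intro f_inv_into_f) simp
  define c where "c = (!) w \<circ> \<sigma>"
  have inj_c: "inj_on c {..<?m}" unfolding c_def
    using \<sigma> inj by (intro comp_inj_on) (auto simp: bij_betw_def K'_def inj_on_subset)
  have c: "c ` {..<?m} = E - greedy_basis I w - {last w}"
  proof -
    have "c ` {..<?m} = (!) w ` K'" using \<sigma> by (simp add: c_def bij_betw_def flip: image_image image_comp)
    also have "\<dots> = (!) w ` ?K - {w ! (?n - 1)}"
      unfolding K'_def using inj lastK by (subst inj_on_image_set_diff[of _ ?K]) auto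
    finally show ?thesis unfolding C last .
  qed
  have "elem_sym (?r - 1) (E - greedy_basis I w - {last w}) z =
      (\<Sum>Q\<in>diag_sets ?n ?r. \<Prod>i\<in>Q. z (c i))"
    unfolding c[symmetric] elem_sym_image[OF inj_c] by (simp add: elem_sym_def diag_sets_def)
  also have "\<dots> = (\<Sum>Q\<in>diag_sets ?n ?r. \<Prod>k\<in>{k \<in> ?K. ?\<nu> k \<in> Q}. z (w ! k))"
  proof (rule sum.cong[OF refl])
    fix Q assume "Q \<in> diag_sets ?n ?r"
    then have Q: "Q \<subseteq> {..<?m}" by (simp add: diag_sets_def)
    \<comment> \<open>The position set aside has number \<open>?m\<close>, which is not in
      \<open>Q\<close>, so \<open>?K\<close> may replace \<open>K'\<close> here.\<close>
    have "\<sigma> ` Q = {k \<in> ?K. ?\<nu> k \<in> Q}"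
    proof (intro equalityI subsetI)
      fix k assume "k \<in> \<sigma> ` Q"
      then obtain i where i: "i \<in> Q" "k = \<sigma> i" by blast
      then have "i < ?m" using Q by auto
      moreover have "\<sigma> i \<in> K'" using \<sigma> \<open>i < ?m\<close> by (auto simp: bij_betw_def)
      ultimately show "k \<in> {k \<in> ?K. ?\<nu> k \<in> Q}" using i \<nu>\<sigma>[of i] by (simp add: K'_def)
    next
      fix k assume k: "k \<in> {k \<in> ?K. ?\<nu> k \<in> Q}"
      then have "?\<nu> k < ?m" using Q by auto
      then have "\<sigma> (?\<nu> k) \<in> ?K" "?\<nu> (\<sigma> (?\<nu> k)) = ?\<nu> k"
        using \<sigma> \<nu>\<sigma> by (auto simp: bij_betw_def K'_def)
      then have "\<sigma> (?\<nu> k) = k" using k inj_\<nu> by (auto dest: inj_onD)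
      then show "k \<in> \<sigma> ` Q" using k by (metis (no_types, lifting) imageI mem_Collect_eq)
    qed
    moreover have "inj_on \<sigma> Q" using \<sigma> Q by (auto simp: bij_betw_def inj_on_subset)
    ultimately have "(\<Prod>k\<in>{k \<in> ?K. ?\<nu> k \<in> Q}. z (w ! k)) = (\<Prod>i\<in>Q. z (w ! \<sigma> i))"
      by (metis (no_types, lifting) prod.reindex_cong)
    then show "(\<Prod>i\<in>Q. z (c i)) = (\<Prod>k\<in>{k \<in> ?K. ?\<nu> k \<in> Q}. z (w ! k))" by (simp add: c_def)
  qed
  finally have "elem_sym (?r - 1) (E - greedy_basis I w - {last w}) z =
      (\<Sum>Q\<in>diag_sets ?n ?r. \<Prod>k\<in>{k \<in> ?K. ?\<nu> k \<in> Q}. z (w ! k))" .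
  moreover have "prod z (E - greedy_basis I w) = (\<Prod>k\<in>?K. z (w ! k))"
    unfolding C using inj by (simp add: prod.reindex)
  ultimately show "elem_sym (?r - 1) (E - greedy_basis I w - {last w}) z * prod z (E - greedy_basis I w) =
      (\<Sum>Q\<in>diag_sets ?n ?r. path_num z (path_height Q) {} w)"
    by (simp add: path_num_path_height[OF dist] sum_distrib_left mult.commute)
qed

end

section \<open>Evaluation of the omega invariant\<close>

lemma to_fract_sum: "to_fract (sum f A) = (\<Sum>x\<in>A. to_fract (f x))"
  by (induction A rule: infinite_finite_induct) auto

lemma to_fract_prod: "to_fract (prod f A) = (\<Prod>x\<in>A. to_fract (f x))"
  by (induction A rule: infinite_finite_induct) auto

lemma Fract_eq_divide: "Fract a b = to_fract a / to_fract b"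
  by (simp add: to_fract_def)

abbreviation zfrac :: "'a \<Rightarrow> 'a zpoly fract" where
  "zfrac e \<equiv> to_fract (zvar e)"

lemma prod_uminus: "(\<Prod>x\<in>A. - f x) = (-1) ^ card A * (\<Prod>x\<in>A. f x :: 'b::comm_ring_1)"
  by (induction A rule: infinite_finite_induct) auto

lemma coeff_neg_X_power: "coeff ((- [:0, 1:] :: 'b::comm_ring_1 poly) ^ i) k = (if i = k then (-1) ^ i else 0)"
proof -
  have "- [:0, 1:] = (monom (-1) 1 :: 'b poly)" by (simp add: monom_Suc monom_0 One_nat_def)
  then show ?thesis by (simp add: monom_power)
qed

text \<open>Exchanging the sums leaves, for each \<open>Q\<close>, the chains with inner members in
  \<open>B \<inter> A Q\<close>, to which Hall's theorem applies. The exponent is one less than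
  there, whence the minus sign.\<close>

lemma chain_lists_card_sum:
  assumes "finite U" "L \<subset> U" "finite \<Q>"
  shows "(\<Sum>Ss\<in>chain_lists B L U. (-1) ^ (length Ss - 2) *
      int (card {Q \<in> \<Q>. set (butlast (tl Ss)) \<subseteq> A Q})) = - (\<Sum>Q\<in>\<Q>. chain_mu (B \<inter> A Q) L U)"
proof -
  have fin: "finite (chain_lists B L U)"
    using assms by (intro chain_lists_sum) auto
  have "(\<Sum>Ss\<in>chain_lists B L U. (-1) ^ (length Ss - 2) *
      int (card {Q \<in> \<Q>. set (butlast (tl Ss)) \<subseteq> A Q})) =
      (\<Sum>Ss\<in>chain_lists B L U. \<Sum>Q\<in>\<Q>.
        if set (butlast (tl Ss)) \<subseteq> A Q then (-1) ^ (length Ss - 2) else 0)"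
    using assms(3) by (simp add: sum.inter_filter[symmetric] mult.commute)
  also have "\<dots> = (\<Sum>Q\<in>\<Q>. \<Sum>Ss\<in>{Ss \<in> chain_lists B L U. set (butlast (tl Ss)) \<subseteq> A Q}.
      (-1) ^ (length Ss - 2))"
    by (subst sum.swap) (simp add: sum.inter_filter[OF fin])
  also have "\<dots> = (\<Sum>Q\<in>\<Q>. - chain_mu (B \<inter> A Q) L U)"
  proof (rule sum.cong[OF refl])
    fix Q
    have "{Ss \<in> chain_lists B L U. set (butlast (tl Ss)) \<subseteq> A Q} = chain_lists (B \<inter> A Q) L U"
      by (auto simp: chain_lists_def)
    moreover have "(-1::int) ^ (length Ss - 2) = - ((-1) ^ (length Ss - 1))"
      if "Ss \<in> chain_lists (B \<inter> A Q) L U" for Ss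
    proof -
      have "Ss \<noteq> []" "hd Ss \<noteq> last Ss" using that assms(2) by (auto simp: chain_lists_def)
      then obtain S T Ts where "Ss = S # T # Ts" by (cases Ss; cases "tl Ss") auto
      then show ?thesis by simp
    qed
    ultimately have "(\<Sum>Ss | Ss \<in> chain_lists B L U \<and> set (butlast (tl Ss)) \<subseteq> A Q. (-1::int) ^ (length Ss - 2)) =
        (\<Sum>Ss\<in>chain_lists (B \<inter> A Q) L U. - ((-1) ^ (length Ss - 1)))"
      by (simp cong: sum.cong)
    also have "\<dots> = - chain_mu (B \<inter> A Q) L U"
      using chain_lists_sum(2)[of U L "B \<inter> A Q"] assms by (simp add: sum_negf psubset_imp_subset)
    finally show "(\<Sum>Ss | Ss \<in> chain_lists B L U \<and> set (butlast (tl Ss)) \<subseteq> A Q. (-1::int) ^ (length Ss - 2)) =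
        - chain_mu (B \<inter> A Q) L U" .
  qed
  finally show ?thesis by (simp add: sum_negf)
qed

lemma set_chain:
  assumes "hd Ss = L" "last Ss = U" "Ss \<noteq> []"
  shows "set Ss = insert L (insert U (set (butlast (tl Ss))))"
proof (cases "tl Ss = []")
  case True
  then show ?thesis using assms by (cases Ss) auto
next
  case False
  then have "Ss = L # butlast (tl Ss) @ [U]"
    using assms by (cases Ss) auto
  then show ?thesis by (metis (no_types, lifting) Un_insert_right empty_set list.simps(15) set_append sup_bot.right_neutral)
qed

context matroid
begin

section \<open>The top coefficient of the polynomial as a sum over orderings\<close>

lemma omega_eq:
  assumes "E \<noteq> {}" "\<not> (\<exists>e. mat_loop E I e \<or> mat_coloop E I e)" "rk E \<ge> 1"
  shows "omega E I = (-1) ^ num_components E I * ((-1) ^ rk E *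
    (\<Sum>j<rk E. best_deg E (g_integrand E I (rk E) j)))"
proof -
  have "coeff ((-1) ^ c * p) k = (-1) ^ c * coeff p k" for c k and p :: "'a zpoly fract poly"
    by (cases "even c") simp_all
  then have "omega E I = (-1) ^ num_components E I *
      (\<Sum>i = 1..rk E. (\<Sum>j<i. best_deg E (g_integrand E I i j)) * (if i = rk E then (-1) ^ i else 0))"
    using assms unfolding omega_def g_poly_def
    by (simp only: if_False coeff_sum coeff_smult coeff_neg_X_power)
  also have "(\<Sum>i = 1..rk E. (\<Sum>j<i. best_deg E (g_integrand E I i j)) * (if i = rk E then (-1) ^ i else 0)) =
      (-1) ^ rk E * (\<Sum>j<rk E. best_deg E (g_integrand E I (rk E) j))"
    using assms(3) by (subst sum.remove[of _ "rk E"]) (auto simp: mult.commute intro!: sum.neutral)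
  finally show ?thesis .
qed

text \<open>For \<open>i = r\<close> the factor in \<open>x\<close> is 1 and the last factor is the
  product of all \<open>- z\<close> over the complement of the greedy basis. Summing over
  \<open>j\<close> removes the last entry by \<open>elem_sym_remove\<close>.\<close>

lemma sum_g_integrand:
  assumes w: "w \<in> permutations_of_set E" and "E \<noteq> {}" "\<not> mat_coloop E I (last w)" "rk E \<ge> 1"
  shows "to_fract (\<Sum>j<rk E. g_integrand E I (rk E) j w) = (-1) ^ (card E - rk E) *
    (\<Sum>Q\<in>diag_sets (card E) (rk E). path_num zfrac (path_height Q) {} w)"
proof -
  let ?C = "E - greedy_basis I w" and ?r = "rk E"
  note K = elem_sym_eq_sum_path_num[OF assms(1-3)]
  have finA: "finite (greedy_basis I w)"
    by (rule finite_subset[of _ "set w"]) (auto simp: greedy_basis_def)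
  have finC: "finite ?C" using finite_ground by simp
  have hom: "to_fract (elem_sym k A zvar) = elem_sym k A zfrac" for k and A :: "'a set"
    by (simp add: elem_sym_def to_fract_sum to_fract_prod)
  obtain k where k: "?r = Suc k" using assms(4) by (cases ?r) auto
  have "(\<Sum>j<?r. g_integrand E I ?r j w) =
      (\<Sum>j<?r. (- zvar (last w)) ^ j * elem_sym (?r - j - 1) ?C zvar * prod (\<lambda>c. - zvar c) ?C)"
    using elem_sym_0[OF finA, of zvar] elem_sym_card[OF finC, of "\<lambda>c. - zvar c"] K(1)
    by (simp add: g_integrand_def Let_def)
  also have "\<dots> = (\<Sum>j\<le>k. (- zvar (last w)) ^ j * elem_sym (k - j) ?C zvar) * prod (\<lambda>c. - zvar c) ?C"
    by (simp add: k lessThan_Suc_atMost sum_distrib_right)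
  also have "\<dots> = elem_sym (?r - 1) (?C - {last w}) zvar * ((-1) ^ (card E - ?r) * prod zvar ?C)"
    using elem_sym_remove[OF finC K(2), of zvar k] K(1) by (simp add: prod_uminus k)
  finally have "to_fract (\<Sum>j<?r. g_integrand E I ?r j w) =
      (-1) ^ (card E - ?r) * (elem_sym (?r - 1) (?C - {last w}) zfrac * prod zfrac ?C)"
    by (cases "even (card E - ?r)") (simp_all add: hom to_fract_prod)
  then show ?thesis unfolding K(3) .
qed

lemma omega_circ_eq_order_sum:
  assumes "E \<noteq> {}" "\<not> (\<exists>e. mat_loop E I e \<or> mat_coloop E I e)" "rk E \<ge> 1"
  shows "omega_circ E I =
    (\<Sum>Q\<in>diag_sets (card E) (rk E). order_sum zfrac (path_height Q) {} E)"
proof -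
  let ?n = "card E" and ?r = "rk E"
  let ?X = "\<lambda>w. \<Sum>Q\<in>diag_sets ?n ?r. path_num zfrac (path_height Q) {} w"
  have n: "?n \<ge> 1" "?r \<le> ?n"
    using assms(1) finite_ground rank_le_card[OF finite_ground] by (auto simp: Suc_le_eq card_gt_0_iff)
  have "(\<Sum>j<?r. best_deg E (g_integrand E I ?r j)) =
      (\<Sum>w\<in>permutations_of_set E. to_fract (\<Sum>j<?r. g_integrand E I ?r j w) /
        to_fract (\<Prod>i<?n - 1. zvar (w ! i) - zvar (w ! Suc i)))"
    unfolding best_deg_def Fract_eq_divide
    by (subst sum.swap) (simp add: to_fract_sum sum_divide_distrib)
  also have "\<dots> = (\<Sum>w\<in>permutations_of_set E. (-1) ^ (?n - ?r) * ?X w / ((-1) ^ (?n - 1) * path_den zfrac w))"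
  proof (rule sum.cong[OF refl])
    fix w assume w: "w \<in> permutations_of_set E"
    have "(\<Prod>i<?n - 1. zfrac (w ! i) - zfrac (w ! Suc i)) =
        (\<Prod>i<?n - 1. - (zfrac (w ! Suc i) - zfrac (w ! i)))" by simp
    also have "\<dots> = (-1) ^ (?n - 1) * path_den zfrac w"
      unfolding prod_uminus path_den_nth length_finite_permutations_of_set[OF w] by simp
    finally have "to_fract (\<Prod>i<?n - 1. zvar (w ! i) - zvar (w ! Suc i)) = (-1) ^ (?n - 1) * path_den zfrac w"
      by (simp add: to_fract_prod)
    then show "to_fract (\<Sum>j<?r. g_integrand E I ?r j w) /
        to_fract (\<Prod>i<?n - 1. zvar (w ! i) - zvar (w ! Suc i)) =
        (-1) ^ (?n - ?r) * ?X w / ((-1) ^ (?n - 1) * path_den zfrac w)"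
      using sum_g_integrand[OF w assms(1) _ assms(3)] assms(2) by auto
  qed
  also have "\<dots> = (-1) ^ (?n - ?r) / (-1) ^ (?n - 1) * (\<Sum>w\<in>permutations_of_set E. ?X w / path_den zfrac w)"
    by (simp only: times_divide_times_eq[symmetric] sum_distrib_left[symmetric])
  \<comment> \<open>The sign of the \<open>y\<close> product meets the sign of the reversed
    denominators, and \<open>?n\<close> cancels. The factor \<open>(-1) ^ ?r\<close> cancels against
    the one in \<open>omega_eq\<close>.\<close>
  also have "(-1) ^ (?n - ?r) / (-1) ^ (?n - 1) = (- ((-1) ^ ?r) :: 'a zpoly fract)"
  proof -
    have "(-1) ^ (?n - ?r) * (-1) ^ ?r = (-1 :: 'a zpoly fract) * (-1) ^ (?n - 1)"
      using n by (simp flip: power_add power_Suc)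
    then show ?thesis
      by (cases "even ?r"; cases "even (?n - 1)") simp_all
  qed
  also have "(\<Sum>w\<in>permutations_of_set E. ?X w / path_den zfrac w) =
      (\<Sum>Q\<in>diag_sets ?n ?r. order_sum zfrac (path_height Q) {} E)"
    unfolding order_sum_def by (subst sum.swap) (simp add: sum_divide_distrib)
  finally have "omega E I = - ((-1) ^ num_components E I) *
      (\<Sum>Q\<in>diag_sets ?n ?r. order_sum zfrac (path_height Q) {} E)"
    using omega_eq[OF assms] by (cases "even ?r") simp_all
  \<comment> \<open>The two component signs differ by one exponent, which absorbs the remaining
    minus sign.\<close>
  moreover have "(-1) powi (int c - 1) * (-1) ^ c = (- 1 :: 'a zpoly fract)" for c
    by (simp add: power_int_diff flip: power_add)
  ultimately show ?thesis
    unfolding omega_circ_def by (simp flip: mult.assoc)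
qed

text \<open>These are the sets whose rank point the path \<open>Q\<close> lies weakly above.\<close>

definition above :: "nat set \<Rightarrow> 'a set set" where
  "above Q = {S. S \<subseteq> E \<and> rk S \<le> card (Q \<inter> {..<nullity S})}"

text \<open>Among its first steps a path has no more diagonal ones than steps, so the rank is at
  most the nullity.\<close>

lemma above_crowded: "S \<in> above Q \<Longrightarrow> crowded E I S"
proof -
  assume S: "S \<in> above Q"
  have "card (Q \<inter> {..<nullity S}) \<le> nullity S"
    using card_mono[of "{..<nullity S}" "Q \<inter> {..<nullity S}"] by simp
  then show ?thesis using S by (auto simp: above_def crowded_def crowd_def)
qed

text \<open>At constant rank the rank point of a larger set moves to the right, where the path is no
  lower.\<close>

lemma above_mono:
  assumes "S \<in> above Q" "S \<subseteq> T" "T \<subseteq> E" "rk T = rk S"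
  shows "T \<in> above Q"
proof -
  have "nullity S \<le> nullity T"
    using assms finite_ground finite_subset by (intro nullity_mono) auto
  then have "card (Q \<inter> {..<nullity S}) \<le> card (Q \<inter> {..<nullity T})" by (intro card_mono) auto
  then show ?thesis using assms by (auto simp: above_def)
qed

lemma num_ferroni_above_rank_points:
  assumes "rk E \<ge> 1" "rk E < card E" "set Ss \<subseteq> Pow E"
  shows "num_ferroni_above (card E) (rk E) (map (rank_point I) Ss) =
    card {Q \<in> diag_sets (card E) (rk E). set Ss \<subseteq> above Q}"
proof -
  have pt: "rank_point I S = (int (nullity S), int (rk S))" if "S \<in> set Ss" for S
    using that assms(3) finite_subset[OF _ finite_ground] rank_le_card[of S]
    by (auto simp: rank_point_def of_nat_diff)
  have "num_ferroni_above (card E) (rk E) (map (rank_point I) Ss) =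
      card {Q \<in> diag_sets (card E) (rk E).
        \<forall>p\<in>set (map (rank_point I) Ss). nat (snd p) \<le> card (Q \<inter> {..<nat (fst p)})}"
    using assms(1,2) by (rule num_ferroni_above_eq) (auto simp: pt)
  moreover have "(\<forall>p\<in>set (map (rank_point I) Ss). nat (snd p) \<le> card (Q \<inter> {..<nat (fst p)})) \<longleftrightarrow>
      set Ss \<subseteq> above Q" for Q
    using assms(3) pt by (auto simp: above_def)
  ultimately show ?thesis by simp
qed

lemma chain_sum_eq:
  assumes "rk E \<ge> 1" "rk E < card E" "E \<noteq> {}" "B \<subseteq> Pow E"
  shows "(\<Sum>Ss\<in>chain_lists B {} E. (-1) ^ (length Ss - 2) *
      int (num_ferroni_above (card E) (rk E) (map (rank_point I) (butlast (tl Ss))))) =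
    - (\<Sum>Q\<in>diag_sets (card E) (rk E). chain_mu (B \<inter> above Q) {} E)"
proof -
  have "(\<Sum>Ss\<in>chain_lists B {} E. (-1) ^ (length Ss - 2) *
      int (num_ferroni_above (card E) (rk E) (map (rank_point I) (butlast (tl Ss))))) =
    (\<Sum>Ss\<in>chain_lists B {} E. (-1) ^ (length Ss - 2) *
      int (card {Q \<in> diag_sets (card E) (rk E). set (butlast (tl Ss)) \<subseteq> above Q}))"
  proof (rule sum.cong[OF refl])
    fix Ss assume "Ss \<in> chain_lists B {} E"
    then have "set (butlast (tl Ss)) \<subseteq> Pow E" using assms(4) by (auto simp: chain_lists_def)
    then show "(-1) ^ (length Ss - 2) *
      int (num_ferroni_above (card E) (rk E) (map (rank_point I) (butlast (tl Ss)))) =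
      (-1) ^ (length Ss - 2) *
      int (card {Q \<in> diag_sets (card E) (rk E). set (butlast (tl Ss)) \<subseteq> above Q})"
      by (simp only: num_ferroni_above_rank_points[OF assms(1,2)])
  qed
  also have "\<dots> = - (\<Sum>Q\<in>diag_sets (card E) (rk E). chain_mu (B \<inter> above Q) {} E)"
    using assms(3) by (intro chain_lists_card_sum finite_ground finite_diag_sets) auto
  finally show ?thesis .
qed

section \<open>Loops, coloops and flats in the family below a path\<close>

lemma diag_sets_card_Int:
  assumes "Q \<in> diag_sets (card E) (rk E)"
  shows "card (Q \<inter> {..<card E - rk E}) = rk E - 1" "card (Q \<inter> X) \<le> rk E - 1"
proof -
  have Q: "Q \<subseteq> {..<card E - rk E - 1}" "card Q = rk E - 1"
    using assms by (auto simp: diag_sets_def)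
  then have "Q \<inter> {..<card E - rk E} = Q" by auto
  then show "card (Q \<inter> {..<card E - rk E}) = rk E - 1" using Q by simp
  have "finite Q" using Q(1) by (rule finite_subset) simp
  then show "card (Q \<inter> X) \<le> rk E - 1" using Q(2) card_mono[of Q "Q \<inter> X"] by simp
qed

text \<open>A path has only \<open>rk E - 1\<close> diagonal steps. Thus \<open>E\<close> enters
  only as the adjoined top, as \<open>chain_mu_closure_top\<close> requires.\<close>

lemma ground_notin_above:
  assumes "Q \<in> diag_sets (card E) (rk E)" "rk E \<ge> 1"
  shows "E \<notin> above Q"
  using diag_sets_card_Int(2)[OF assms(1), of "{..<nullity E}"] assms(2) by (simp add: above_def)

text \<open>Adding the loop \<open>e\<close> keeps the rank, so it is a closure operator on the
  family. The set \<open>{e}\<close> belongs to the family and the bottom is not closed.\<close>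

lemma chain_mu_above_loop:
  assumes "Q \<in> diag_sets (card E) (rk E)" "rk E \<ge> 1" "mat_loop E I e"
  shows "chain_mu (above Q) {} E = 0"
proof -
  have e: "e \<in> E" using assms(3) by (simp add: mat_loop_def)
  have "chain_mu (above Q) {} E = (if insert e {} = {} then chain_mu {T \<in> above Q. insert e T = T} {} E else 0)"
  proof (rule chain_mu_closure_top[OF finite_ground])
    show "T \<subseteq> insert e T \<and> insert e (insert e T) = insert e T \<and> insert e T \<in> insert {} (above Q)"
      if T: "T \<in> insert {} (above Q)" for T
    proof -
      have "{e} \<in> above Q"
        using e loop_rank_insert[OF assms(3), of "{}"] by (simp add: above_def rank_empty)
      moreover have "insert e T \<in> above Q" if "T \<in> above Q"
        using that e by (rule_tac above_mono[OF that]) (auto simp: above_def loop_rank_insert[OF assms(3)])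
      ultimately show ?thesis using T by auto
    qed
    show "E \<notin> above Q" by (rule ground_notin_above[OF assms(1,2)])
  qed (use e in auto)
  then show ?thesis by simp
qed

text \<open>Deleting the coloop \<open>e\<close> lowers the rank and keeps the nullity, so it
  preserves the family.\<close>

lemma chain_mu_above_coloop:
  assumes "Q \<in> diag_sets (card E) (rk E)" "rk E \<ge> 1" "rk E < card E" "mat_coloop E I e"
  shows "chain_mu (above Q) {} E = 0"
proof -
  have e: "e \<in> E" using assms(4) by (simp add: mat_coloop_def)
  show ?thesis
  proof (rule chain_mu_kernel_eq_0[OF finite_ground, of _ e])
    fix T assume T: "T \<in> insert E (above Q)" "e \<in> T" "T \<subseteq> E"
    have "finite T" using T(3) finite_ground by (rule finite_subset)
    have "rk T = Suc (rk (T - {e}))"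
      using coloop_rank_insert[OF assms(4), of "T - {e}"] T by (auto simp: insert_absorb)
    moreover have "card T = Suc (card (T - {e}))"
      using \<open>finite T\<close> T(2) by (metis card_Suc_Diff1)
    ultimately have null: "nullity (T - {e}) = nullity T" "Suc (rk (T - {e})) = rk T" by auto
    show "T - {e} \<in> above Q \<and> T - {e} \<noteq> {}"
    proof (cases "T = E")
      case True
      \<comment> \<open>For the top, the deletion has rank \<open>rk E - 1\<close> and full nullity,
        where \<open>Q\<close> has taken all its diagonal steps.\<close>
      then have "T - {e} \<in> above Q"
        using null diag_sets_card_Int(1)[OF assms(1)] by (auto simp: above_def)
      moreover have "T - {e} \<noteq> {}"
      proof
        assume "T - {e} = {}"
        then have "E = {e}" using True e by auto
        then show False using assms(2,3) by simp
      qed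
      ultimately show ?thesis by simp
    next
      case False
      then have A: "rk T \<le> card (Q \<inter> {..<nullity T})" using T(1) by (auto simp: above_def)
      then have "T - {e} \<in> above Q" using null T(3) by (auto simp: above_def)
      moreover have "T - {e} \<noteq> {}"
      proof
        assume "T - {e} = {}"
        then have "T = {e}" using T(2) by auto
        then have "nullity T = 0" using null by (simp add: rank_empty)
        then show False using A null(2) by simp
      qed
      ultimately show ?thesis by simp
    qed
  qed (use e in auto)
qed

text \<open>Matroid closure preserves rank and hence the family. Looplessness makes the bottom
  closed, so the Moebius value survives the passage to flats.\<close>

lemma chain_mu_above_flats:
  assumes "Q \<in> diag_sets (card E) (rk E)" "rk E \<ge> 1" "E \<noteq> {}" "\<forall>e\<in>E. \<not> mat_loop E I e"
  shows "chain_mu (above Q) {} E = chain_mu {F \<in> above Q. cl F = F} {} E"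
proof -
  note cl0 = loopless_closure_empty[OF assms(4)]
  have "chain_mu (above Q) {} E = (if cl {} = {} then chain_mu {T \<in> above Q. cl T = T} {} E else 0)"
  proof (rule chain_mu_closure_top[OF finite_ground])
    show "T \<subseteq> cl T \<and> cl (cl T) = cl T \<and> cl T \<in> insert {} (above Q)"
      if T: "T \<in> insert {} (above Q)" "T \<subset> E" for T
    proof -
      have "T \<subseteq> E" using T(2) by blast
      note * = closure_extensive[OF this] closure_idem[OF this] rank_closure[OF this]
      have "cl T \<in> above Q" if "T \<in> above Q"
        by (rule above_mono[OF that]) (rule * closure_subset)+
      then show ?thesis using * T(1) cl0 by auto
    qed
    show "cl S \<subseteq> T" if "S \<subseteq> T" "cl T = T" for S T using closure_mono[OF that(1)] that(2) by simp
    show "E \<notin> above Q" by (rule ground_notin_above[OF assms(1,2)])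
    show "cl E = E" by (rule closure_ground)
  qed (use assms(3) in auto)
  then show ?thesis using cl0 by simp
qed

lemma omega_circ_eq_chain_mu:
  assumes "E \<noteq> {}" "rk E \<ge> 1" "rk E < card E"
  shows "omega_circ E I = of_int (- (\<Sum>Q\<in>diag_sets (card E) (rk E). chain_mu (above Q) {} E))"
proof (cases "\<exists>e. mat_loop E I e \<or> mat_coloop E I e")
  case True
  then have "omega_circ E I = 0"
    using assms(1) by (simp add: omega_circ_def omega_def g_poly_def)
  moreover have "chain_mu (above Q) {} E = 0" if "Q \<in> diag_sets (card E) (rk E)" for Q
    using True chain_mu_above_loop[OF that assms(2)] chain_mu_above_coloop[OF that assms(2,3)] by blast
  ultimately show ?thesis by simp
next
  case False
  have "order_sum zfrac (path_height Q) {} E = - of_int (chain_mu (above Q) {} E)"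
    if Q: "Q \<in> diag_sets (card E) (rk E)" for Q
  proof -
    have "order_sum_value zfrac (path_height Q) {} E"
    proof (rule order_sum_eval)
      show "path_height Q S \<le> path_height Q T" if "S \<subseteq> T" "T \<subseteq> E" for S T
        using finite_subset[OF that(2) finite_ground] that(1) by (rule path_height_mono)
    qed (use finite_ground assms(1) in \<open>auto simp: inj_on_def zvar_inj\<close>)
    \<comment> \<open>The full path contributes \<open>rk E - 1\<close> to the nullity of
      \<open>E\<close>, so the order sum has degree exactly 0.\<close>
    moreover have h: "path_height Q {} = 0" "path_height Q E = card E - 1"
      using diag_sets_card_Int(1)[OF Q] assms(2,3) by (auto simp: path_height_def)
    ultimately have "order_sum zfrac (path_height Q) {} E =
        - of_int (chain_mu {T. card T \<le> path_height Q T} {} E)"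
      using assms(3) by (simp add: order_sum_value_def)
    moreover have "chain_mu {T. card T \<le> path_height Q T} {} E = chain_mu (above Q) {} E"
    proof (rule chain_mu_cong[OF finite_ground])
      fix T assume T: "T \<subset> E"
      \<comment> \<open>As \<open>card T\<close> is rank plus nullity, cancelling the nullity turns
        the threshold into the condition in \<open>above\<close>.\<close>
      then have "rk T \<le> card T"
        using finite_ground by (intro rank_le_card) (auto intro: finite_subset)
      then show "T \<in> {T. card T \<le> path_height Q T} \<longleftrightarrow> T \<in> above Q"
        using T by (auto simp: above_def path_height_def)
    qed
    ultimately show ?thesis by simp
  qed
  then show ?thesis
    unfolding omega_circ_eq_order_sum[OF assms(1) False assms(2)] by (simp add: sum_negf)
qed

end

theorem proposition10p4:
  fixes E :: "'a set" and I :: "'a set set" and n r :: nat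
  assumes "matroid E I"
    and "E \<noteq> {}"
    and "card E = n"
    and "mat_rank I E = r"
    and "n \<ge> 2 * r"
  shows "omega_circ E I = of_int (\<Sum>Ss\<in>crowded_chains E I.
        (-1) ^ (length Ss - 2) *
        int (num_ferroni_above n r (map (rank_point I) (butlast (tl Ss))))) \<and>
    ((\<forall>e\<in>E. \<not> mat_loop E I e) \<longrightarrow>
      omega_circ E I = of_int (\<Sum>Fs\<in>crowded_flat_chains E I.
        (-1) ^ (length Fs - 2) *
        int (num_ferroni_above n r (map (rank_point I) (butlast (tl Fs))))))"
proof -
  interpret matroid E I by fact
  note [simp] = assms(3,4)
  have n: "n \<ge> 1" using assms(2) finite_ground by (auto simp flip: assms(3) simp: Suc_le_eq card_gt_0_iff)
  show ?thesis
  proof (cases "r = 0")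
    case True
    obtain e where "e \<in> E" using assms(2) by blast
    \<comment> \<open>In rank 0 every element is a loop, so \<open>omega_circ\<close> vanishes, as
      do all path counts, and the hypothesis of the formula for flats fails.\<close>
    then have loop: "mat_loop E I e"
      using rank_ge[of "{e}" E] True assms(4) by (auto simp: mat_loop_def)
    then have "omega_circ E I = 0"
      using assms(2) by (auto simp: omega_circ_def omega_def g_poly_def)
    moreover have "num_ferroni_above n r ps = 0" for ps
      by (simp add: num_ferroni_above_def True ferroni_paths_rank_0)
    ultimately show ?thesis using loop \<open>e \<in> E\<close> by auto
  next
    case False
    then have r: "rk E \<ge> 1" "rk E < card E" using n assms(5) by auto
    \<comment> \<open>The assumption \<open>n \<ge> 2 * r\<close> makes \<open>E\<close> crowded, so
      crowdedness constrains only the inner members of a chain.\<close>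
    have ends: "crowded E I {}" "crowded E I E"
      using assms(5) by (auto simp: crowded_def crowd_def rank_empty)
    have "crowded_chains E I = chain_lists {S. crowded E I S} {} E"
    proof -
      have "(\<forall>S\<in>set Ss. crowded E I S) \<longleftrightarrow> set (butlast (tl Ss)) \<subseteq> {S. crowded E I S}"
        if "Ss \<noteq> []" "hd Ss = {}" "last Ss = E" for Ss
        using set_chain[OF that(2,3,1)] ends by auto
      then show ?thesis unfolding crowded_chains_def chain_lists_def by blast
    qed
    moreover have "{S. crowded E I S} \<inter> above Q = above Q" for Q
      using above_crowded by blast
    moreover have "{S. crowded E I S} \<subseteq> Pow E" by (auto simp: crowded_def)
    ultimately have 1: "(\<Sum>Ss\<in>crowded_chains E I. (-1) ^ (length Ss - 2) *
        int (num_ferroni_above n r (map (rank_point I) (butlast (tl Ss))))) =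
        - (\<Sum>Q\<in>diag_sets (card E) (rk E). chain_mu (above Q) {} E)"
      using chain_sum_eq[OF r assms(2), of "{S. crowded E I S}"] by simp
    have 2: "(\<Sum>Fs\<in>crowded_flat_chains E I. (-1) ^ (length Fs - 2) *
        int (num_ferroni_above n r (map (rank_point I) (butlast (tl Fs))))) =
        - (\<Sum>Q\<in>diag_sets (card E) (rk E). chain_mu (above Q) {} E)"
      if loopless: "\<forall>e\<in>E. \<not> mat_loop E I e"
    proof -
      let ?B = "{F. mat_flat E I F \<and> crowded E I F}"
      \<comment> \<open>Without loops the minimum flat is empty, so chains of flats run between the
        same ends as chains of sets.\<close>
      note cl0 = loopless_closure_empty[OF loopless]
      have flats: "mat_flat E I {}" "mat_flat E I E" by (simp_all add: mat_flat_def cl0 closure_ground)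
      have "(\<forall>S\<in>set Ss. mat_flat E I S \<and> crowded E I S) \<longleftrightarrow> set (butlast (tl Ss)) \<subseteq> ?B"
        if "Ss \<noteq> []" "hd Ss = {}" "last Ss = E" for Ss
        using set_chain[OF that(2,3,1)] ends flats by auto
      then have "crowded_flat_chains E I = chain_lists ?B {} E"
        unfolding crowded_flat_chains_def chain_lists_def cl0 by blast
      moreover have "?B \<inter> above Q = {F \<in> above Q. cl F = F}" for Q
        using above_crowded by (auto simp: mat_flat_def above_def)
      moreover have "?B \<subseteq> Pow E" by (auto simp: crowded_def)
      ultimately show ?thesis
        using chain_sum_eq[OF r assms(2), of ?B] chain_mu_above_flats[OF _ r(1) assms(2) loopless]
        by simp
    qed
    show ?thesis
      using omega_circ_eq_chain_mu[OF assms(2) r] 1 2 by simp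
  qed
qed

end
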